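(* Let $0\le\alpha<1$, let $M_{\alpha}$ be the discrete fractional maximal operator, let $q(\cdot):\mathbb{Z}\to[1,\infty)$ be an exponent sequence, and let $\frac{1}{1-\alpha}<s<q_{-}$. If $(q(\cdot)/s)'\in\mathcal{B}$, $p(\cdot)$ is the exponent sequence given by $\frac{1}{p(i)}=\frac{1}{q(i)}+\alpha$ for all $i\in\mathbb{Z}$, and $\theta\in(1,\infty)$, then there exists a positive constant $C$ such that \[ \left\|\left\{\sum_{k=1}^{\infty}(M_{\alpha}a_k)^{\theta}\right\}^{1/\theta}\right\|_{\ell^{q(\cdot)}}\le C\left\|\left\{\sum_{k=1}^{\infty}|a_k|^{\theta}\right\}^{1/\theta}\right\|_{\ell^{p(\cdot)}} \] for all sequences of functions $\{a_k:\mathbb{Z}\to\mathbb{C}\,:\,k\in\mathbb{N}\}$ with finite support (i.e. each $a_k$ has finite support).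
   Context: For an exponent sequence $p(\cdot):\mathbb{Z}\to[1,\infty)$ put $p_{-}=\inf\{p(i):i\in\mathbb{Z}\}$ and $p_{+}=\sup\{p(i):i\in\mathbb{Z}\}$ (and similarly $q_{-},q_{+}$ for $q(\cdot)$). For a sequence $a=\{a(i)\}_{i\in\mathbb{Z}}$ put \[ \|a\|_{\ell^{p(\cdot)}}=\inf\Big\{\lambda>0:\sum_{i\in\mathbb{Z}}|a(i)/\lambda|^{p(i)}\le 1\Big\}, \] and let $\ell^{p(\cdot)}=\ell^{p(\cdot)}(\mathbb{Z})$ be the set of complex sequences with $\|a\|_{\ell^{p(\cdot)}}<\infty$. Norms may take the value $+\infty$ (infimum of the empty set), also for $[0,\infty]$-valued sequences, and the inequality is understood in $[0,\infty]$. The conjugate exponent $p'(\cdot)$ is defined by $\frac{1}{p(i)}+\frac{1}{p'(i)}=1$ for all $i\in\mathbb{Z}$. Here $(q(\cdot)/s)'$ denotes the conjugate exponent of the sequence $i\mapsto q(i)/s$. For $0\le\alpha<1$, the discrete fractional maximal operator is \[ (M_{\alpha}a)(j)=\sup\frac{1}{(n-m+1)^{1-\alpha}}\sum_{i=m}^{n}|a(i)|,\qquad j\in\mathbb{Z}, \] the supremum being over all $m,n\in\mathbb{Z}$ with $m\le j\le n$; $M=M_0$ is the discrete Hardy-Littlewood maximal operator. Let $\mathcal{P}$ be the set of $p(\cdot):\mathbb{Z}\to[1,\infty)$ with $1<p_{-}\le p_{+}<\infty$, and let $\mathcal{B}$ be the set of $p(\cdot)\in\mathcal{P}$ such that $M$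 is bounded on $\ell^{p(\cdot)}$ (i.e. there is a constant $K$ with $\|Ma\|_{\ell^{p(\cdot)}}\le K\|a\|_{\ell^{p(\cdot)}}$ for all $a\in\ell^{p(\cdot)}$). The operations $\left\{\sum_{k}(M_{\alpha}a_k)^{\theta}\right\}^{1/\theta}$ and $\left\{\sum_k|a_k|^{\theta}\right\}^{1/\theta}$ are taken pointwise in $j\in\mathbb{Z}$. The constant $C$ does not depend on the sequence $\{a_k\}$. *)

theory Defs
  imports "HOL-Analysis.Analysis"
begin

(* Real powers on [0,\<infinity>], only meant for positive exponents r: 0 is sent to 0 and
   \<infinity> to \<infinity>. *)
definition ennpowr :: "ennreal \<Rightarrow> real \<Rightarrow> ennreal" where
  "ennpowr x r = (if x = \<infinity> then \<infinity> else ennreal (enn2real x powr r))"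

definition exponent_seq :: "(int \<Rightarrow> real) \<Rightarrow> bool" where
  "exponent_seq p \<longleftrightarrow> (\<forall>i. 1 \<le> p i)"

(* Extended reals, because the supremum of an unbounded exponent has to be \<infinity>. *)
definition exp_minus :: "(int \<Rightarrow> real) \<Rightarrow> ereal" where
  "exp_minus p = (INF i. ereal (p i))"

definition exp_plus :: "(int \<Rightarrow> real) \<Rightarrow> ereal" where
  "exp_plus p = (SUP i. ereal (p i))"

(* Solves 1/p(i) + 1/p'(i) = 1. Only meant for p(i) > 1; the true value \<infinity> at p(i) = 1
   is not representable here (the formula then gives the junk value 0). *)
definition conj_exp :: "(int \<Rightarrow> real) \<Rightarrow> int \<Rightarrow> real" where
  "conj_exp p i = 1 / (1 - 1 / p i)"

lemma conj_exp_iff: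
  assumes "p i > 1"
  shows "1 / p i + 1 / r = 1 \<longleftrightarrow> r = conj_exp p i"
proof -
  have "1 - 1 / p i \<noteq> 0"
    using assms by auto
  then show ?thesis
    unfolding conj_exp_def by (cases "r = 0") (auto simp: field_simps)
qed

(* The functional on [0,\<infinity>]-valued sequences; a complex sequence a is measured through
   its modulus. The infimum of the empty set is \<infinity>. *)
definition lp_norm :: "(int \<Rightarrow> real) \<Rightarrow> (int \<Rightarrow> ennreal) \<Rightarrow> ennreal" where
  "lp_norm p a =
     Inf {ennreal l | l::real. l > 0 \<and> (\<Sum>\<^sub>\<infinity>i\<in>UNIV. ennpowr (a i / ennreal l) (p i)) \<le> 1}"

definition modulus :: "(int \<Rightarrow> complex) \<Rightarrow> int \<Rightarrow> ennreal" where
  "modulus a i = ennreal (cmod (a i))"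

definition lp_space :: "(int \<Rightarrow> real) \<Rightarrow> (int \<Rightarrow> complex) set" where
  "lp_space p = {a. lp_norm p (modulus a) < \<infinity>}"

definition frac_max :: "real \<Rightarrow> (int \<Rightarrow> complex) \<Rightarrow> int \<Rightarrow> ennreal" where
  "frac_max \<alpha> a j =
     (SUP (m, n)\<in>{(m, n). m \<le> j \<and> j \<le> n}.
        ennreal (1 / (real_of_int (n - m + 1) powr (1 - \<alpha>)) * (\<Sum>i=m..n. cmod (a i))))"

abbreviation HL_max :: "(int \<Rightarrow> complex) \<Rightarrow> int \<Rightarrow> ennreal" where
  "HL_max \<equiv> frac_max 0"

definition class_P :: "(int \<Rightarrow> real) set" where
  "class_P = {p. exponent_seq p \<and> 1 < exp_minus p \<and> exp_minus p \<le> exp_plus p \<and> exp_plus p < \<infinity>}"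

definition class_B :: "(int \<Rightarrow> real) set" where
  "class_B = {p \<in> class_P. \<exists>K::real. \<forall>a\<in>lp_space p.
     lp_norm p (HL_max a) \<le> ennreal K * lp_norm p (modulus a)}"

end

theory Submission
  imports Defs
begin

text \<open>
The proof is an extrapolation argument. Write \<open>F\<close> and \<open>G\<close> for the pointwise \<open>\<theta>\<close>-norms of \<open>(M\<^sub>\<alpha> a\<^sub>k)\<close> and
\<open>(a\<^sub>k)\<close>, and \<open>1 / r = 1 / s + \<alpha>\<close>, so that \<open>1 < r \<le> s\<close>. The norm of \<open>F\<close> in \<open>\<ell>\<close> with exponent \<open>q\<close> is governed
by pairings \<open>\<Sum> F\<^sup>s h\<close> with \<open>h\<close> in the unit ball for the exponent \<open>(q/s)'\<close>. Since \<open>M\<close> is bounded there,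
iterating it majorises \<open>h\<close> by an \<open>A\<^sub>1\<close> weight \<open>u\<close> of comparable size (\<open>rubio_de_francia\<close>). A weighted
inequality \<open>\<Sum> F\<^sup>s u \<le> D (\<Sum> G\<^sup>r u powr (r/s)) powr (s/r)\<close> and Young's inequality then finish the proof
(\<open>off_diagonal_extrapolation\<close>).

The weighted inequality is reduced to one without any condition on the weight. If \<open>M u \<le> D u\<close>, the
\<open>u\<close>-measure of an interval is at most \<open>D\<close> times its length times the value of \<open>u\<close> at any of its points, so
\<open>M\<^sub>\<alpha> f\<close> is dominated, up to a constant, by the fractional maximal function of \<open>f u powr (-\<alpha>)\<close> with respect
to the measure \<open>u\<close> (\<open>wmax_A1_inner\<close>). On the line, maximal functions over intervals are bounded on \<open>L\<^sup>p\<close>,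
\<open>p > 1\<close>, of every measure, with a constant that depends on \<open>p\<close> only; the maximal ergodic lemma is behind
this (\<open>wmax_strong\<close>). Hedberg's
argument gives the fractional bound from \<open>L\<^sup>r\<close> to \<open>L\<^sup>s\<close> (\<open>wmax_fractional\<close>).

It remains to pass from single functions to the \<open>\<theta>\<close>-norm of a family, for an arbitrary measure \<open>w\<close>. If
\<open>r \<le> \<theta> \<le> s\<close>, Minkowski's inequality does it. For \<open>\<theta> < r\<close> and \<open>\<theta> > s\<close> the same mechanism is used once more
with constant exponents: an \<open>A\<^sub>1\<close> majorant \<open>u\<close> with respect to \<open>w\<close> reduces the bound to the first case at
other exponents and for the measure \<open>u w\<close> (\<open>vector_bound_below\<close>, \<open>vector_bound_above\<close>).

All of this takes place on a finite interval \<open>{A..B}\<close> and for finitely many functions, with constants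
independent of both: by finiteness of the supports only intervals inside a large \<open>{A..B}\<close> matter, and the
infinite sums over points and over \<open>k\<close> are limits of finite ones.
\<close>

section \<open>Convexity inequalities for powers\<close>

text \<open>The graph of \<open>x \<mapsto> x\<^sup>p\<close> lies above its tangent at \<open>y\<close>. Summed over points, this
gives Jensen's inequality; between two levels, it compares increments of \<open>x powr (p - 1)\<close> and \<open>x powr p\<close>.\<close>
lemma young_tangent:
  fixes x y p :: real
  assumes "1 \<le> p" "0 \<le> x" "0 \<le> y"
  shows "p * x * y powr (p - 1) \<le> x powr p + (p - 1) * y powr p"
proof (cases "x = 0 \<or> y = 0")
  case False
  have "(x powr p) powr (1/p) * (y powr p) powr (1 - 1/p) \<le> 1/p * x powr p + (1 - 1/p) * y powr p"
    using assms False by (intro Youngs_inequality_0) auto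
  moreover have "(x powr p) powr (1/p) = x" "p * (1 - 1/p) = p - 1"
    using assms by (auto simp: powr_powr field_simps)
  ultimately have "x * y powr (p - 1) \<le> 1/p * x powr p + (1 - 1/p) * y powr p"
    by (simp add: powr_powr)
  then have "p * (x * y powr (p - 1)) \<le> p * (1/p * x powr p + (1 - 1/p) * y powr p)"
    using assms by (intro mult_left_mono) auto
  then show ?thesis
    using assms by (simp add: algebra_simps)
qed (use assms in auto)

text \<open>Young's inequality with its coefficients \<open>t, 1 - t\<close> bounded by 1. This loss makes the bound uniform
in \<open>t\<close>, and so applicable when \<open>t\<close> is built from a variable exponent.\<close>
lemma young_sum:
  fixes a b t :: real
  assumes "0 \<le> a" "0 \<le> b" "0 \<le> t" "t \<le> 1"
  shows "a powr t * b powr (1 - t) \<le> a + b"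
proof (cases "a = 0 \<or> b = 0")
  case False
  then have "a powr t * b powr (1 - t) \<le> t * a + (1 - t) * b"
    using assms by (intro Youngs_inequality_0) auto
  also have "\<dots> \<le> a + b"
    using assms by (intro add_mono mult_left_le_one_le) auto
  finally show ?thesis .
qed (use assms in auto)

text \<open>Weights of total mass at most 1 suffice because the power vanishes at 0: sum the tangent
inequality at the mean.\<close>
lemma jensen_powr:
  fixes c x :: "'i \<Rightarrow> real"
  assumes "1 \<le> p" and c: "\<And>i. i \<in> I \<Longrightarrow> 0 \<le> c i" and x: "\<And>i. i \<in> I \<Longrightarrow> 0 \<le> x i"
    and c1: "(\<Sum>i\<in>I. c i) \<le> 1"
  shows "(\<Sum>i\<in>I. c i * x i) powr p \<le> (\<Sum>i\<in>I. c i * x i powr p)"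
proof -
  define y where "y = (\<Sum>i\<in>I. c i * x i)"
  have y: "0 \<le> y" unfolding y_def by (intro sum_nonneg mult_nonneg_nonneg c x)
  have yy: "y * y powr (p - 1) = y powr p"
    using y by (cases "y = 0") (auto simp: powr_mult_base)
  have "p * y powr p = (\<Sum>i\<in>I. c i * (p * x i * y powr (p - 1)))"
    unfolding yy[symmetric] by (subst (1) y_def) (simp add: sum_distrib_left sum_distrib_right mult_ac)
  also have "\<dots> \<le> (\<Sum>i\<in>I. c i * (x i powr p + (p - 1) * y powr p))"
    using assms y by (intro sum_mono mult_left_mono young_tangent) auto
  also have "\<dots> = (\<Sum>i\<in>I. c i * x i powr p) + (\<Sum>i\<in>I. c i) * ((p - 1) * y powr p)"
    by (simp add: sum.distrib sum_distrib_right distrib_left)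
  also have "\<dots> \<le> (\<Sum>i\<in>I. c i * x i powr p) + 1 * ((p - 1) * y powr p)"
    using assms by (intro add_left_mono mult_right_mono) auto
  finally show ?thesis by (simp add: y_def algebra_simps)
qed

text \<open>Normalising each \<open>X k\<close> by its norm \<open>c k\<close> turns the sum into \<open>\<Sum>k. c k\<close> times a convex combination
of functions of norm 1, to which Jensen's inequality applies pointwise.\<close>
lemma minkowski_sum:
  fixes v :: "'j \<Rightarrow> real" and X :: "'k \<Rightarrow> 'j \<Rightarrow> real"
  assumes t: "1 \<le> t" and "finite J" "finite K"
    and v: "\<And>j. j \<in> J \<Longrightarrow> 0 \<le> v j" and X: "\<And>k j. k \<in> K \<Longrightarrow> j \<in> J \<Longrightarrow> 0 \<le> X k j"
  shows "(\<Sum>j\<in>J. v j * (\<Sum>k\<in>K. X k j) powr t) powr (1/t) \<le> (\<Sum>k\<in>K. (\<Sum>j\<in>J. v j * X k j powr t) powr (1/t))"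
proof -
  define c where "c k = (\<Sum>j\<in>J. v j * X k j powr t) powr (1/t)" for k
  define C where "C = (\<Sum>k\<in>K. c k)"
  have c0: "0 \<le> c k" for k by (simp add: c_def)
  have ct: "(\<Sum>j\<in>J. v j * X k j powr t) = c k powr t" for k
  proof -
    have "0 \<le> (\<Sum>j\<in>J. v j * X k j powr t)"
      by (intro sum_nonneg mult_nonneg_nonneg v) auto
    then show ?thesis using t by (simp add: c_def powr_powr)
  qed
  have zero: "v j = 0 \<or> X k j = 0" if "c k = 0" "j \<in> J" "k \<in> K" for k j
  proof -
    have "(\<Sum>j\<in>J. v j * X k j powr t) = 0" using ct[of k] that by simp
    then have "v j * X k j powr t = 0"
      using that v by (subst (asm) sum_nonneg_eq_0_iff) (use assms in auto)
    then show ?thesis using that X[of k j] t by auto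
  qed
  show ?thesis
  proof (cases "C = 0")
    case True
    have ck: "c k = 0" if "k \<in> K" for k
      using True that c0 assms by (auto simp: C_def sum_nonneg_eq_0_iff)
    have "v j * (\<Sum>k\<in>K. X k j) powr t = 0" if "j \<in> J" for j
    proof (cases "v j = 0")
      case False
      then have "(\<Sum>k\<in>K. X k j) = 0" using zero ck that by (intro sum.neutral) auto
      then show ?thesis by simp
    qed auto
    then have "(\<Sum>j\<in>J. v j * (\<Sum>k\<in>K. X k j) powr t) = 0" by (intro sum.neutral) auto
    then show ?thesis by (simp add: sum_nonneg)
  next
    case False
    then have C: "0 < C" using c0 by (simp add: C_def sum_nonneg order_less_le)
    have pt: "v j * (\<Sum>k\<in>K. X k j) powr t
        \<le> C powr t * (\<Sum>k\<in>K. c k / C * (v j * (X k j / c k) powr t))" if j: "j \<in> J" for j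
    proof (cases "v j = 0")
      case False
      have "(\<Sum>k\<in>K. X k j) = C * (\<Sum>k\<in>K. c k / C * (X k j / c k))"
        unfolding sum_distrib_left using zero[OF _ j] False C by (intro sum.cong) (auto simp: field_simps)
      then have "(\<Sum>k\<in>K. X k j) powr t = C powr t * (\<Sum>k\<in>K. c k / C * (X k j / c k)) powr t"
        using C c0 X j by (subst powr_mult[symmetric]) (auto intro!: sum_nonneg)
      also have "\<dots> \<le> C powr t * (\<Sum>k\<in>K. c k / C * (X k j / c k) powr t)"
        using C c0 X j t by (intro mult_left_mono jensen_powr)
          (auto simp: C_def simp flip: sum_divide_distrib)
      finally have "v j * (\<Sum>k\<in>K. X k j) powr t \<le> v j * (C powr t * (\<Sum>k\<in>K. c k / C * (X k j / c k) powr t))"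
        using v[OF j] by (intro mult_left_mono)
      then show ?thesis by (simp add: sum_distrib_left mult_ac)
    qed auto
    have norm1: "(\<Sum>j\<in>J. v j * (X k j / c k) powr t) \<le> 1" if k: "k \<in> K" for k
    proof (cases "c k = 0")
      case False
      have "(\<Sum>j\<in>J. v j * (X k j / c k) powr t) = (\<Sum>j\<in>J. v j * X k j powr t) / c k powr t"
        unfolding sum_divide_distrib using X[OF k] c0 by (intro sum.cong) (auto simp: powr_divide)
      also have "\<dots> = 1" using False ct by simp
      finally show ?thesis by simp
    qed auto
    have "(\<Sum>j\<in>J. v j * (\<Sum>k\<in>K. X k j) powr t)
        \<le> (\<Sum>j\<in>J. C powr t * (\<Sum>k\<in>K. c k / C * (v j * (X k j / c k) powr t)))"
      by (intro sum_mono pt)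
    also have "\<dots> = C powr t * (\<Sum>k\<in>K. c k / C * (\<Sum>j\<in>J. v j * (X k j / c k) powr t))"
      unfolding sum_distrib_left by (rule sum.swap)
    also have "\<dots> \<le> C powr t * (\<Sum>k\<in>K. c k / C * 1)"
      using c0 C norm1 by (intro mult_left_mono sum_mono) auto
    also have "\<dots> = C powr t" using C by (simp add: C_def flip: sum_divide_distrib)
    finally have "(\<Sum>j\<in>J. v j * (\<Sum>k\<in>K. X k j) powr t) powr (1/t) \<le> (C powr t) powr (1/t)"
      using t v by (intro powr_mono2) (auto intro!: sum_nonneg)
    also have "\<dots> = C" using t C by (simp add: powr_powr)
    finally show ?thesis by (simp add: C_def c_def)
  qed
qed

section \<open>From weak to strong type\<close>

text \<open>The maximal ergodic lemma (rising sun lemma): the starting points of the runs with nonnegative sum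
carry a nonnegative sum themselves. The case \<open>n = A - 1\<close>, where the left-hand side is empty, is the
one of interest; the general \<open>n\<close> makes the induction on the left end point \<open>A\<close> work.\<close>
lemma maximal_ergodic:
  fixes x :: "int \<Rightarrow> real"
  assumes "A \<le> B + 1" "A - 1 \<le> n" "n \<le> B"
  shows "(\<Sum>i=A..n. x i) \<le> (\<Sum>j | j \<in> {A..B} \<and> (\<exists>n\<in>{j..B}. 0 \<le> (\<Sum>i=j..n. x i)). x j)"
  using assms
proof (induction A arbitrary: n rule: int_le_induct)
  case base
  then show ?case by simp
next
  case (step A)
  define E where "E A = {j \<in> {A..B}. \<exists>n\<in>{j..B}. 0 \<le> (\<Sum>i=j..n. x i)}" for A
  have fin: "finite (E A)" for A
    by (rule finite_subset[of _ "{A..B}"]) (auto simp: E_def)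
  have IH: "(\<Sum>i=A..n. x i) \<le> (\<Sum>j\<in>E A. x j)" if "A - 1 \<le> n" "n \<le> B" for n
    using step.IH that by (simp add: E_def)
  have split: "(\<Sum>i=A-1..n. x i) = x (A-1) + (\<Sum>i=A..n. x i)" if "A - 1 \<le> n" for n
  proof -
    have "{A-1..n} = insert (A-1) {A..n}" using that by auto
    then show ?thesis by simp
  qed
  have "(\<Sum>i=A-1..n. x i) \<le> (\<Sum>j\<in>E (A-1). x j)"
  proof (cases "\<exists>n\<in>{A-1..B}. 0 \<le> (\<Sum>i=A-1..n. x i)")
    case True
    then obtain n' where n': "A - 1 \<le> n'" "n' \<le> B" "0 \<le> (\<Sum>i=A-1..n'. x i)" by auto
    have E1: "E (A-1) = insert (A-1) (E A)" using True by (auto simp: E_def)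
    then have E: "(\<Sum>j\<in>E (A-1). x j) = x (A-1) + (\<Sum>j\<in>E A. x j)"
      using fin[of A] by (subst E1, subst sum.insert) (auto simp: E_def)
    show ?thesis
    proof (cases "A - 1 \<le> n")
      case True
      then show ?thesis using split[OF True] IH[of n] step.prems E by simp
    next
      case False
      then show ?thesis using split[of n'] IH[of n'] n' E by simp
    qed
  next
    case False
    then have "E (A-1) = E A"
      using step.hyps by (auto simp: E_def) (metis atLeastAtMost_iff order.trans zle_diff1_eq linorder_not_le order_le_less)
    moreover have "0 \<le> (\<Sum>j\<in>E A. x j)" using IH[of "A-1"] step by simp
    moreover have "(\<Sum>i=A-1..n. x i) \<le> 0"
    proof (cases "A - 1 \<le> n")
      case True
      then have "\<not> 0 \<le> (\<Sum>i=A-1..n. x i)" using False step.prems by auto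
      then show ?thesis by simp
    qed simp
    ultimately show ?thesis by simp
  qed
  then show ?case by (simp add: E_def)
qed

text \<open>Weak type inequalities on all superlevel sets of \<open>g\<close> imply a strong type inequality: this is the
integral of the hypothesis against \<open>l powr (p - 2)\<close>, carried out one value of \<open>g\<close> at a time. The
base level \<open>c\<close> rises in the induction: the points where \<open>g\<close> attains its minimum \<open>v\<close> drop out, and the
contribution of the layer between \<open>c\<close> and \<open>v\<close> is controlled by the tangent inequality.\<close>
lemma strong_type_from_superlevel_sets:
  fixes f g w :: "'i \<Rightarrow> real"
  assumes p: "1 < p" and "finite X" and "0 \<le> c" and "\<And>i. i \<in> X \<Longrightarrow> 0 \<le> w i"
    and "\<And>i. i \<in> X \<Longrightarrow> c \<le> g i"
    and "\<And>l. c \<le> l \<Longrightarrow> l * (\<Sum>i | i \<in> X \<and> l \<le> g i. w i) \<le> (\<Sum>i | i \<in> X \<and> l \<le> g i. f i * w i)"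
  shows "(p - 1) * (\<Sum>i\<in>X. w i * (g i powr p - c powr p))
      \<le> p * (\<Sum>i\<in>X. w i * (f i * (g i powr (p - 1) - c powr (p - 1))))"
  using assms(2-)
proof (induction "card X" arbitrary: X c rule: less_induct)
  case less
  show ?case
  proof (cases "X = {}")
    case False
    define v where "v = Min (g ` X)"
    define Y where "Y = {i \<in> X. v < g i}"
    have vX: "v \<le> g i" if "i \<in> X" for i using that less by (simp add: v_def)
    obtain i0 where i0: "i0 \<in> X" "g i0 = v"
      using Min_in[of "g ` X"] less.prems(1) False unfolding v_def by fastforce
    have cv: "c \<le> v" using i0 less by metis
    have YX: "Y \<subseteq> X" by (auto simp: Y_def)
    have g_eq: "g i = v" if "i \<in> X - Y" for i
      using vX[of i] that by (simp add: Y_def)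
    have "Y \<subset> X" using i0 by (auto simp: Y_def)
    then have card: "card Y < card X" using less by (intro psubset_card_mono) auto
    have "(p - 1) * (\<Sum>i\<in>Y. w i * (g i powr p - v powr p))
      \<le> p * (\<Sum>i\<in>Y. w i * (f i * (g i powr (p - 1) - v powr (p - 1))))"
    proof (rule less.hyps[OF card])
      fix l assume l: "v \<le> l"
      show "l * (\<Sum>i | i \<in> Y \<and> l \<le> g i. w i) \<le> (\<Sum>i | i \<in> Y \<and> l \<le> g i. f i * w i)"
      proof (cases "l = v")
        case False
        then have "{i. i \<in> Y \<and> l \<le> g i} = {i. i \<in> X \<and> l \<le> g i}" using l by (auto simp: Y_def)
        then show ?thesis using less.prems(5)[of l] l cv by simp
      next
        case True
        then have eq: "{i. i \<in> Y \<and> l \<le> g i} = Y" by (auto simp: Y_def)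
        show ?thesis
        proof (cases "Y = {}")
          case False
          \<comment> \<open>At the level \<open>v\<close> itself \<open>Y\<close> is not a superlevel set of \<open>g\<close> on \<open>X\<close>; the next higher value gives it.\<close>
          define v' where "v' = Min (g ` Y)"
          have fY: "finite Y" using less by (simp add: Y_def)
          have "v' \<in> g ` Y" unfolding v'_def using fY False by (intro Min_in) auto
          then have v': "v \<le> v'" by (auto simp: Y_def)
          have "v' \<le> g i" if "i \<in> Y" for i using that fY by (simp add: v'_def)
          moreover have "v < v'" using \<open>v' \<in> g ` Y\<close> by (auto simp: Y_def)
          ultimately have "{i. i \<in> X \<and> v' \<le> g i} = Y" by (auto simp: Y_def)
          then have "v' * (\<Sum>i\<in>Y. w i) \<le> (\<Sum>i\<in>Y. f i * w i)"
            using less.prems(5)[of v'] cv v' by simp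
          moreover have "v * (\<Sum>i\<in>Y. w i) \<le> v' * (\<Sum>i\<in>Y. w i)"
            using v' less.prems(3) by (intro mult_right_mono sum_nonneg) (auto simp: Y_def)
          ultimately show ?thesis unfolding eq unfolding True by linarith
        qed (simp add: eq)
      qed
    qed (use less.prems vX cv in \<open>auto simp: Y_def\<close>)
    moreover have "(\<Sum>i\<in>Y. w i * (g i powr p - v powr p)) = (\<Sum>i\<in>X. w i * (g i powr p - v powr p))"
      by (rule sum.mono_neutral_left) (use less.prems(1) YX g_eq in \<open>simp_all\<close>)
    moreover have "(\<Sum>i\<in>Y. w i * (f i * (g i powr (p - 1) - v powr (p - 1))))
        = (\<Sum>i\<in>X. w i * (f i * (g i powr (p - 1) - v powr (p - 1))))"
      by (rule sum.mono_neutral_left) (use less.prems(1) YX g_eq in \<open>simp_all\<close>)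
    ultimately have above: "(p - 1) * (\<Sum>i\<in>X. w i * (g i powr p - v powr p))
        \<le> p * (\<Sum>i\<in>X. w i * (f i * (g i powr (p - 1) - v powr (p - 1))))" by simp
    have "{i \<in> X. v \<le> g i} = X" using vX by auto
    then have base: "v * (\<Sum>i\<in>X. w i) \<le> (\<Sum>i\<in>X. f i * w i)"
      using less.prems(5)[OF cv] by simp
    have v0: "0 \<le> v" using cv less by simp
    have vv: "v * v powr (p - 1) = v powr p"
      using v0 by (cases "v = 0") (auto simp: powr_mult_base)
    have "(p - 1) * (v powr p - c powr p) \<le> p * v * (v powr (p - 1) - c powr (p - 1))"
      using young_tangent[of p v c] p v0 less.prems vv by (simp add: algebra_simps)
    then have "(p - 1) * (v powr p - c powr p) * (\<Sum>i\<in>X. w i)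
        \<le> p * v * (v powr (p - 1) - c powr (p - 1)) * (\<Sum>i\<in>X. w i)"
      using less.prems by (intro mult_right_mono sum_nonneg) auto
    also have "\<dots> = p * (v powr (p - 1) - c powr (p - 1)) * (v * (\<Sum>i\<in>X. w i))"
      by simp
    also have "\<dots> \<le> p * (v powr (p - 1) - c powr (p - 1)) * (\<Sum>i\<in>X. f i * w i)"
      using p cv less.prems by (intro mult_left_mono base mult_nonneg_nonneg) (auto intro!: powr_mono2)
    finally have bottom: "(p - 1) * ((v powr p - c powr p) * (\<Sum>i\<in>X. w i))
        \<le> p * ((v powr (p - 1) - c powr (p - 1)) * (\<Sum>i\<in>X. f i * w i))"
      by (simp add: mult.assoc)
    have "(\<Sum>i\<in>X. w i * (g i powr p - c powr p))
        = (\<Sum>i\<in>X. w i * (g i powr p - v powr p)) + (v powr p - c powr p) * (\<Sum>i\<in>X. w i)"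
      unfolding sum_distrib_left sum.distrib[symmetric] by (intro sum.cong refl) (simp add: algebra_simps)
    moreover have "(\<Sum>i\<in>X. w i * (f i * (g i powr (p - 1) - c powr (p - 1))))
        = (\<Sum>i\<in>X. w i * (f i * (g i powr (p - 1) - v powr (p - 1))))
          + (v powr (p - 1) - c powr (p - 1)) * (\<Sum>i\<in>X. f i * w i)"
      unfolding sum_distrib_left sum.distrib[symmetric] by (intro sum.cong refl) (simp add: algebra_simps)
    ultimately show ?thesis using above bottom by (simp only: distrib_left add_mono)
  qed simp
qed

section \<open>Maximal functions with respect to a measure on an interval\<close>

text \<open>The uncentred fractional maximal function with respect to the measure with density \<open>w\<close>, over the
subintervals of \<open>{A..B}\<close>; \<open>w = (\<lambda>_. 1)\<close> gives the operator of the theorem. Outside \<open>{A..B}\<close>, where no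
interval competes, the value 0 keeps it nonnegative.\<close>
definition wmax :: "int \<Rightarrow> int \<Rightarrow> real \<Rightarrow> (int \<Rightarrow> real) \<Rightarrow> (int \<Rightarrow> real) \<Rightarrow> int \<Rightarrow> real" where
  "wmax A B \<alpha> w f j = (if j \<in> {A..B} then
     Max ((\<lambda>(m, n). (\<Sum>i=m..n. f i * w i) * (\<Sum>i=m..n. w i) powr (\<alpha> - 1)) ` ({A..j} \<times> {j..B})) else 0)"

lemma wmax_leI:
  assumes "A \<le> j" "j \<le> B"
    and "\<And>m n. A \<le> m \<Longrightarrow> m \<le> j \<Longrightarrow> j \<le> n \<Longrightarrow> n \<le> B \<Longrightarrow>
      (\<Sum>i=m..n. f i * w i) * (\<Sum>i=m..n. w i) powr (\<alpha> - 1) \<le> c"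
  shows "wmax A B \<alpha> w f j \<le> c"
  using assms by (auto simp: wmax_def)

lemma wmax_ge:
  assumes "A \<le> m" "m \<le> j" "j \<le> n" "n \<le> B"
  shows "(\<Sum>i=m..n. f i * w i) * (\<Sum>i=m..n. w i) powr (\<alpha> - 1) \<le> wmax A B \<alpha> w f j"
  using assms by (auto simp: wmax_def intro!: Max_ge)

lemma wmax_nonneg:
  assumes "\<And>i. 0 < w i" "\<And>i. 0 \<le> f i"
  shows "0 \<le> wmax A B \<alpha> w f j"
proof (cases "j \<in> {A..B}")
  case True
  have "0 \<le> (\<Sum>i=j..j. f i * w i) * (\<Sum>i=j..j. w i) powr (\<alpha> - 1)"
    using assms by (simp add: order_less_imp_le)
  also have "\<dots> \<le> wmax A B \<alpha> w f j" using True by (intro wmax_ge) auto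
  finally show ?thesis .
next
  case False
  then show ?thesis by (auto simp: wmax_def)
qed

lemma wmax_scale:
  assumes "0 < c" "j \<in> {A..B}"
  shows "wmax A B \<alpha> w f j \<le> 1 / c * wmax A B \<alpha> w (\<lambda>i. f i * c) j"
proof (rule wmax_leI)
  fix m n assume mn: "A \<le> m" "m \<le> j" "j \<le> n" "n \<le> B"
  have "(\<Sum>i=m..n. f i * c * w i) * (\<Sum>i=m..n. w i) powr (\<alpha> - 1) \<le> wmax A B \<alpha> w (\<lambda>i. f i * c) j"
    using mn by (intro wmax_ge) auto
  moreover have "(\<Sum>i=m..n. f i * c * w i) = c * (\<Sum>i=m..n. f i * w i)"
    by (simp add: sum_distrib_left mult_ac)
  ultimately show "(\<Sum>i=m..n. f i * w i) * (\<Sum>i=m..n. w i) powr (\<alpha> - 1) \<le> 1 / c * wmax A B \<alpha> w (\<lambda>i. f i * c) j"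
    using assms by (simp add: field_simps)
qed (use assms in auto)

text \<open>The superlevel sets of the one-sided maximal function are the sets of the maximal ergodic lemma for
the sequence \<open>(f - l) w\<close>. No regularity of \<open>w\<close> enters.\<close>
lemma right_max_strong_type:
  fixes f w :: "int \<Rightarrow> real"
  assumes p: "1 < p" and AB: "A \<le> B" and w: "\<And>i. 0 < w i" and f: "\<And>i. 0 \<le> f i"
  defines "g j \<equiv> Max ((\<lambda>n. (\<Sum>i=j..n. f i * w i) / (\<Sum>i=j..n. w i)) ` {j..B})"
  shows "(\<Sum>i=A..B. w i * g i powr p) \<le> (p / (p - 1)) powr p * (\<Sum>i=A..B. w i * f i powr p)"
proof -
  have pos: "0 < (\<Sum>i=j..n. w i)" if "j \<le> n" for j n :: int
    using that w by (intro sum_pos) auto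
  have g0: "0 \<le> g j" if "j \<in> {A..B}" for j
  proof -
    have "f j \<le> g j" unfolding g_def
      using that w[of j] by (intro Max_ge) (auto intro!: image_eqI[of _ _ j])
    then show ?thesis using f[of j] by simp
  qed
  have "(p - 1) * (\<Sum>i\<in>{A..B}. w i * (g i powr p - 0 powr p))
      \<le> p * (\<Sum>i\<in>{A..B}. w i * (f i * (g i powr (p - 1) - 0 powr (p - 1))))"
  proof (rule strong_type_from_superlevel_sets[OF p])
    fix l :: real assume l: "0 \<le> l"
    have "l \<le> g j \<longleftrightarrow> (\<exists>n\<in>{j..B}. 0 \<le> (\<Sum>i=j..n. (f i - l) * w i))" if "j \<in> {A..B}" for j
    proof -
      have "l \<le> g j \<longleftrightarrow> (\<exists>n\<in>{j..B}. l \<le> (\<Sum>i=j..n. f i * w i) / (\<Sum>i=j..n. w i))"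
        unfolding g_def using that by (subst Max_ge_iff) auto
      also have "\<dots> \<longleftrightarrow> (\<exists>n\<in>{j..B}. 0 \<le> (\<Sum>i=j..n. (f i - l) * w i))"
      proof (intro bex_cong refl)
        fix n assume "n \<in> {j..B}"
        then show "l \<le> (\<Sum>i=j..n. f i * w i) / (\<Sum>i=j..n. w i) \<longleftrightarrow> 0 \<le> (\<Sum>i=j..n. (f i - l) * w i)"
          using pos[of j n] by (simp add: le_divide_eq left_diff_distrib sum_subtractf sum_distrib_left)
      qed
      finally show ?thesis .
    qed
    then have E: "{j. j \<in> {A..B} \<and> (\<exists>n\<in>{j..B}. 0 \<le> (\<Sum>i=j..n. (f i - l) * w i))} = {i. i \<in> {A..B} \<and> l \<le> g i}"
      by auto
    have "0 \<le> (\<Sum>j | j \<in> {A..B} \<and> l \<le> g j. (f j - l) * w j)"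
      using maximal_ergodic[of A B "A - 1" "\<lambda>i. (f i - l) * w i"] AB unfolding E by simp
    then show "l * (\<Sum>i | i \<in> {A..B} \<and> l \<le> g i. w i) \<le> (\<Sum>i | i \<in> {A..B} \<and> l \<le> g i. f i * w i)"
      by (simp add: left_diff_distrib sum_subtractf sum_distrib_left)
  qed (use w g0 in \<open>auto intro: order_less_imp_le\<close>)
  then have main: "(p - 1) * (\<Sum>i=A..B. w i * g i powr p) \<le> p * (\<Sum>i=A..B. w i * (f i * g i powr (p - 1)))"
    using p by simp
  define a where "a = p / (p - 1)"
  have a: "0 < a" "(p - 1) * a = p" using p by (auto simp: a_def)
  have "a * (p * (\<Sum>i=A..B. w i * (f i * g i powr (p - 1)))) = (\<Sum>i=A..B. w i * (p * (a * f i) * g i powr (p - 1)))"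
    by (simp add: sum_distrib_left mult_ac)
  also have "\<dots> \<le> (\<Sum>i=A..B. w i * (a powr p * f i powr p + (p - 1) * g i powr p))"
    using young_tangent[of p "a * f _" "g _"] p a f g0 w
    by (intro sum_mono mult_left_mono) (auto simp: powr_mult order_less_imp_le)
  also have "\<dots> = a powr p * (\<Sum>i=A..B. w i * f i powr p) + (p - 1) * (\<Sum>i=A..B. w i * g i powr p)"
    by (simp add: sum_distrib_left distrib_left sum.distrib mult_ac)
  finally have *: "a * (p * (\<Sum>i=A..B. w i * (f i * g i powr (p - 1)))) \<le> \<dots>" .
  have "p * (\<Sum>i=A..B. w i * g i powr p) = a * ((p - 1) * (\<Sum>i=A..B. w i * g i powr p))"
    using a by (metis mult.assoc mult.commute)
  also have "\<dots> \<le> a * (p * (\<Sum>i=A..B. w i * (f i * g i powr (p - 1))))"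
    using main a by (intro mult_left_mono) auto
  finally show ?thesis using * by (simp add: a_def algebra_simps)
qed

lemma sum_reflect_int: "(\<Sum>i=m..n. h (- i)) = (\<Sum>i=-n..-m. h i)" for m n :: int
  by (rule sum.reindex_bij_witness[of _ uminus uminus]) auto

lemma left_max_strong_type:
  fixes f w :: "int \<Rightarrow> real"
  assumes p: "1 < p" and AB: "A \<le> B" and w: "\<And>i. 0 < w i" and f: "\<And>i. 0 \<le> f i"
  defines "g j \<equiv> Max ((\<lambda>m. (\<Sum>i=m..j. f i * w i) / (\<Sum>i=m..j. w i)) ` {A..j})"
  shows "(\<Sum>i=A..B. w i * g i powr p) \<le> (p / (p - 1)) powr p * (\<Sum>i=A..B. w i * f i powr p)"
proof -
  define h where "h j = Max ((\<lambda>n. (\<Sum>i=j..n. f (- i) * w (- i)) / (\<Sum>i=j..n. w (- i))) ` {j..-A})" for j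
  have gh: "h (- j) = g j" for j
  proof -
    have "{- j..- A} = uminus ` {A..j}" by (auto intro: image_eqI[of _ _ "- _"])
    then show ?thesis
      unfolding h_def g_def sum_reflect_int[of "\<lambda>i. f i * w i"] sum_reflect_int[of w]
      by (simp only: image_image minus_minus)
  qed
  have "(\<Sum>i=-B..-A. w (- i) * h i powr p) \<le> (p / (p - 1)) powr p * (\<Sum>i=-B..-A. w (- i) * f (- i) powr p)"
    unfolding h_def using assms by (intro right_max_strong_type) auto
  moreover have "(\<Sum>i=-B..-A. w (- i) * h i powr p) = (\<Sum>i=A..B. w i * g i powr p)"
    using sum_reflect_int[of "\<lambda>i. w i * g i powr p" "-B" "-A"] gh[of "- _"] by simp
  moreover have "(\<Sum>i=-B..-A. w (- i) * f (- i) powr p) = (\<Sum>i=A..B. w i * f i powr p)"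
    using sum_reflect_int[of "\<lambda>i. w i * f i powr p" "-B" "-A"] by simp
  ultimately show ?thesis by simp
qed

text \<open>An interval containing \<open>j\<close> is cut at \<open>j\<close> into two intervals of no larger measure, hence the maximal
function is at most the sum of its two one-sided versions. The constant depends on \<open>p\<close> only; that
it is the same for every weight is what allows changes of measure later on.\<close>
lemma wmax_strong:
  assumes p: "1 < p" and AB: "A \<le> B" and w: "\<And>i. 0 < w i" and f: "\<And>i. 0 \<le> f i"
  shows "(\<Sum>i=A..B. w i * wmax A B 0 w f i powr p) \<le> (4 * p / (p - 1)) powr p * (\<Sum>i=A..B. w i * f i powr p)"
proof -
  define g where "g j = Max ((\<lambda>n. (\<Sum>i=j..n. f i * w i) / (\<Sum>i=j..n. w i)) ` {j..B})" for j
  define h where "h j = Max ((\<lambda>m. (\<Sum>i=m..j. f i * w i) / (\<Sum>i=m..j. w i)) ` {A..j})" for j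
  have pos: "0 < (\<Sum>i=j..n. w i)" if "j \<le> n" for j n :: int
    using that w by (intro sum_pos) auto
  have fw: "0 \<le> f i * w i" for i using f[of i] w[of i] by simp
  have pt: "wmax A B 0 w f j \<le> g j + h j" "0 \<le> g j" "0 \<le> h j" if j: "j \<in> {A..B}" for j
  proof -
    have "f j \<le> g j" unfolding g_def
      using that w[of j] by (intro Max_ge) (auto intro!: image_eqI[of _ _ j])
    then show g0: "0 \<le> g j" using f[of j] by simp
    have "f j \<le> h j" unfolding h_def
      using that w[of j] by (intro Max_ge) (auto intro!: image_eqI[of _ _ j])
    then show h0: "0 \<le> h j" using f[of j] by simp
    show "wmax A B 0 w f j \<le> g j + h j"
    proof (rule wmax_leI)
      fix m n assume mn: "A \<le> m" "m \<le> j" "j \<le> n" "n \<le> B"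
      have "(\<Sum>i=j..n. f i * w i) / (\<Sum>i=j..n. w i) \<le> g j"
        unfolding g_def using mn by (intro Max_ge) auto
      then have 1: "(\<Sum>i=j..n. f i * w i) \<le> g j * (\<Sum>i=j..n. w i)"
        using pos[of j n] mn by (simp add: divide_le_eq)
      have "(\<Sum>i=m..j. f i * w i) / (\<Sum>i=m..j. w i) \<le> h j"
        unfolding h_def using mn by (intro Max_ge) auto
      then have 2: "(\<Sum>i=m..j. f i * w i) \<le> h j * (\<Sum>i=m..j. w i)"
        using pos[of m j] mn by (simp add: divide_le_eq)
      have "(\<Sum>i=m..n. f i * w i) \<le> (\<Sum>i=m..j. f i * w i) + (\<Sum>i=j..n. f i * w i)"
      proof -
        have "{m..n} = {m..j} \<union> {j..n}" using mn by auto
        then have "(\<Sum>i=m..n. f i * w i) + (\<Sum>i\<in>{m..j} \<inter> {j..n}. f i * w i) = (\<Sum>i=m..j. f i * w i) + (\<Sum>i=j..n. f i * w i)"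
          by (simp only: sum.union_inter finite_atLeastAtMost_int)
        moreover have "0 \<le> (\<Sum>i\<in>{m..j} \<inter> {j..n}. f i * w i)" by (intro sum_nonneg fw)
        ultimately show ?thesis by linarith
      qed
      also have "\<dots> \<le> h j * (\<Sum>i=m..j. w i) + g j * (\<Sum>i=j..n. w i)"
        using 1 2 by simp
      also have "\<dots> \<le> h j * (\<Sum>i=m..n. w i) + g j * (\<Sum>i=m..n. w i)"
        using g0 h0 mn w by (intro add_mono mult_left_mono sum_mono2) (auto intro: order_less_imp_le)
      also have "\<dots> = (g j + h j) * (\<Sum>i=m..n. w i)" by (simp add: algebra_simps)
      finally show "(\<Sum>i=m..n. f i * w i) * (\<Sum>i=m..n. w i) powr (0 - 1) \<le> g j + h j"
        using pos[of m n] mn by (simp add: powr_minus divide_simps)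
    qed (use j in auto)
  qed
  have two: "(x + y) powr p \<le> 2 powr p * (x powr p + y powr p)" if "0 \<le> x" "0 \<le> y" for x y :: real
  proof -
    have "(x + y) powr p \<le> (2 * max x y) powr p" using that p by (intro powr_mono2) auto
    also have "\<dots> = 2 powr p * max x y powr p" using that by (simp add: powr_mult)
    also have "\<dots> \<le> 2 powr p * (x powr p + y powr p)" by (intro mult_left_mono) (auto simp: max_def)
    finally show ?thesis .
  qed
  have "(\<Sum>i=A..B. w i * wmax A B 0 w f i powr p) \<le> (\<Sum>i=A..B. w i * (2 powr p * (g i powr p + h i powr p)))"
  proof (intro sum_mono mult_left_mono)
    fix i assume i: "i \<in> {A..B}"
    have "wmax A B 0 w f i powr p \<le> (g i + h i) powr p"
      using pt[OF i] p wmax_nonneg[of w f] w f by (intro powr_mono2) auto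
    also have "\<dots> \<le> 2 powr p * (g i powr p + h i powr p)" using pt[OF i] by (intro two)
    finally show "wmax A B 0 w f i powr p \<le> 2 powr p * (g i powr p + h i powr p)" .
  qed (use w in \<open>auto intro: order_less_imp_le\<close>)
  also have "\<dots> = 2 powr p * ((\<Sum>i=A..B. w i * g i powr p) + (\<Sum>i=A..B. w i * h i powr p))"
    by (simp add: sum_distrib_left sum.distrib algebra_simps)
  also have "\<dots> \<le> 2 powr p * ((p / (p - 1)) powr p * (\<Sum>i=A..B. w i * f i powr p) + (p / (p - 1)) powr p * (\<Sum>i=A..B. w i * f i powr p))"
    unfolding g_def h_def using assms by (intro mult_left_mono add_mono right_max_strong_type left_max_strong_type) auto
  also have "\<dots> = 2 powr 1 * 2 powr p * (p / (p - 1)) powr p * (\<Sum>i=A..B. w i * f i powr p)"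
    by simp
  also have "\<dots> \<le> 2 powr p * 2 powr p * (p / (p - 1)) powr p * (\<Sum>i=A..B. w i * f i powr p)"
    using p w powr_mono[of 1 p "2::real"]
    by (intro mult_right_mono) (auto intro!: sum_nonneg mult_nonneg_nonneg order_less_imp_le[OF w])
  also have "2 powr p * 2 powr p * (p / (p - 1)) powr p = (4 * p / (p - 1)) powr p"
    using p by (subst powr_mult[symmetric], simp, simp, subst powr_mult[symmetric]) auto
  finally show ?thesis .
qed

lemma wmax_strong_modular:
  assumes p: "1 < p" and w: "\<And>i. 0 < w i" and h: "\<And>i. 0 \<le> h i"
    and h1: "(\<Sum>i=A..B. w i * h i powr p) \<le> 1"
  shows "(\<Sum>i=A..B. w i * (wmax A B 0 w h i / (4 * p / (p - 1))) powr p) \<le> 1"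
proof (cases "A \<le> B")
  case True
  define K where "K = 4 * p / (p - 1)"
  have K: "0 < K" using p by (simp add: K_def)
  have "(\<Sum>i=A..B. w i * (wmax A B 0 w h i / K) powr p) = (\<Sum>i=A..B. w i * wmax A B 0 w h i powr p) / K powr p"
    using K wmax_nonneg[of w h] w h by (simp add: powr_divide sum_divide_distrib)
  also have "\<dots> \<le> K powr p * 1 / K powr p"
    unfolding K_def using wmax_strong[OF p True w h] h1
    by (intro divide_right_mono order_trans[OF wmax_strong[OF p True w h]] mult_left_mono) auto
  also have "\<dots> = 1" using K by simp
  finally show ?thesis by (simp only: K_def)
qed simp

text \<open>Hedberg's argument: by Jensen's inequality the mean \<open>a\<close> of \<open>f\<close> over an interval of measure \<open>W\<close>
satisfies \<open>W a\<^sup>r \<le> N\<close> with \<open>N = \<Sum> w f\<^sup>r\<close>. Trading the factor \<open>W powr \<alpha>\<close> for powers of \<open>a\<close> and \<open>N\<close> bounds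
the fractional maximal function pointwise by a power of the ordinary one.\<close>
lemma wmax_fractional:
  assumes r: "1 < r" and s: "0 < s" and \<alpha>: "0 \<le> \<alpha>" and rs: "1 / r = 1 / s + \<alpha>"
    and AB: "A \<le> B" and w: "\<And>i. 0 < w i" and f: "\<And>i. 0 \<le> f i"
  shows "(\<Sum>i=A..B. w i * wmax A B \<alpha> w f i powr s)
    \<le> (4 * r / (r - 1)) powr r * (\<Sum>i=A..B. w i * f i powr r) powr (s / r)"
proof -
  define N where "N = (\<Sum>i=A..B. w i * f i powr r)"
  have wf0: "0 \<le> w i * f i powr r" for i using w[of i] by simp
  have N0: "0 \<le> N" unfolding N_def by (intro sum_nonneg wf0)
  have rs': "r / s + r * \<alpha> = 1" using rs r s by (simp add: field_simps)
  have pt: "wmax A B \<alpha> w f j \<le> wmax A B 0 w f j powr (r / s) * N powr \<alpha>" if j: "j \<in> {A..B}" for j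
  proof (rule wmax_leI)
    fix m n assume mn: "A \<le> m" "m \<le> j" "j \<le> n" "n \<le> B"
    define W where "W = (\<Sum>i=m..n. w i)"
    define a where "a = (\<Sum>i=m..n. f i * w i) / W"
    have W: "0 < W" unfolding W_def using mn w by (intro sum_pos) auto
    have a0: "0 \<le> a" unfolding a_def using W w f by (intro divide_nonneg_pos sum_nonneg mult_nonneg_nonneg) (auto simp: order_less_imp_le)
    have aM: "a \<le> wmax A B 0 w f j"
      using wmax_ge[OF mn, of f w 0] W by (simp add: a_def W_def[symmetric] powr_minus divide_inverse)
    have "a powr r = (\<Sum>i=m..n. (w i / W) * f i) powr r"
      by (simp add: a_def sum_divide_distrib mult.commute)
    also have "\<dots> \<le> (\<Sum>i=m..n. (w i / W) * f i powr r)"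
      using r W w f by (intro jensen_powr) (auto simp: order_less_imp_le W_def simp flip: sum_divide_distrib)
    also have "\<dots> = (\<Sum>i=m..n. w i * f i powr r) / W"
      by (simp add: sum_divide_distrib)
    also have "\<dots> \<le> N / W"
      unfolding N_def using W mn wf0 by (intro divide_right_mono sum_mono2) auto
    finally have aN: "a powr r \<le> N / W" .
    have "(\<Sum>i=m..n. f i * w i) * W powr (\<alpha> - 1) = a * W powr \<alpha>"
      using W by (simp add: a_def powr_diff)
    also have "a = a powr (r / s) * (a powr r) powr \<alpha>"
      using a0 by (simp add: powr_powr rs' flip: powr_add)
    also have "a powr (r / s) * (a powr r) powr \<alpha> * W powr \<alpha> \<le> a powr (r / s) * (N / W) powr \<alpha> * W powr \<alpha>"
      using aN \<alpha> by (intro mult_left_mono mult_right_mono powr_mono2) auto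
    also have "\<dots> = a powr (r / s) * N powr \<alpha>"
      using W N0 by (simp add: powr_divide)
    also have "\<dots> \<le> wmax A B 0 w f j powr (r / s) * N powr \<alpha>"
      using aM a0 r s by (intro mult_right_mono powr_mono2) auto
    finally show "(\<Sum>i=m..n. f i * w i) * (\<Sum>i=m..n. w i) powr (\<alpha> - 1) \<le> wmax A B 0 w f j powr (r / s) * N powr \<alpha>"
      by (simp add: W_def)
  qed (use j in auto)
  have "(\<Sum>i=A..B. w i * wmax A B \<alpha> w f i powr s)
      \<le> (\<Sum>i=A..B. w i * (N powr (\<alpha> * s) * wmax A B 0 w f i powr r))"
  proof (intro sum_mono mult_left_mono)
    fix i assume i: "i \<in> {A..B}"
    have "wmax A B \<alpha> w f i powr s \<le> (wmax A B 0 w f i powr (r / s) * N powr \<alpha>) powr s"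
      using pt[OF i] s wmax_nonneg[of w f] w f by (intro powr_mono2) auto
    also have "\<dots> = N powr (\<alpha> * s) * wmax A B 0 w f i powr r"
      using s by (simp add: powr_mult powr_powr)
    finally show "wmax A B \<alpha> w f i powr s \<le> N powr (\<alpha> * s) * wmax A B 0 w f i powr r" .
  qed (use w in \<open>auto intro: order_less_imp_le\<close>)
  also have "\<dots> = N powr (\<alpha> * s) * (\<Sum>i=A..B. w i * wmax A B 0 w f i powr r)"
    by (simp add: sum_distrib_left mult_ac)
  also have "\<dots> \<le> N powr (\<alpha> * s) * ((4 * r / (r - 1)) powr r * N)"
    unfolding N_def using wmax_strong[OF r AB w f] by (intro mult_left_mono) auto
  also have "\<dots> = (4 * r / (r - 1)) powr r * (N powr (\<alpha> * s) * N powr 1)"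
    using N0 by simp
  also have "N powr (\<alpha> * s) * N powr 1 = N powr (s / r)"
  proof -
    have "\<alpha> * s + 1 = s / r" using rs s by (simp add: field_simps)
    then show ?thesis by (simp only: powr_add[symmetric])
  qed
  finally show ?thesis by (simp add: N_def)
qed

section \<open>Majorants in the class A1 and change of measure\<close>

text \<open>Rubio de Francia's iteration. The series \<open>\<Sum>k. (M/K)\<^sup>k h / 2\<^sup>k\<close> dominates \<open>h\<close>, is nearly invariant
under \<open>M\<close> (an \<open>A\<^sub>1\<close> weight), and half of it is a convex combination of functions of modular at most 1.
Working with the modular rather than a norm treats constant and variable exponents alike. The
nonzero value \<open>h j0\<close> makes \<open>u\<close> strictly positive, so that \<open>u w\<close> is again an admissible weight.\<close>
lemma rubio_de_francia:
  fixes w h :: "int \<Rightarrow> real" and \<tau> :: "int \<Rightarrow> real"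
  assumes w: "\<And>i. 0 < w i" and \<tau>: "\<And>i. i \<in> {A..B} \<Longrightarrow> 1 \<le> \<tau> i" and K: "0 < K"
    and bdd: "\<And>h. (\<And>i. 0 \<le> h i) \<Longrightarrow> (\<Sum>i=A..B. w i * h i powr \<tau> i) \<le> 1 \<Longrightarrow>
      (\<Sum>i=A..B. w i * (wmax A B 0 w h i / K) powr \<tau> i) \<le> 1"
    and h: "\<And>i. 0 \<le> h i" "(\<Sum>i=A..B. w i * h i powr \<tau> i) \<le> 1" and j0: "j0 \<in> {A..B}" "h j0 \<noteq> 0"
  obtains u where "\<And>i. 0 < u i" "\<And>i. i \<in> {A..B} \<Longrightarrow> h i \<le> u i"
    "\<And>i. i \<in> {A..B} \<Longrightarrow> wmax A B 0 w u i \<le> 2 * K * u i"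
    "(\<Sum>i=A..B. w i * (u i / 2) powr \<tau> i) \<le> 1"
proof -
  define g where "g = rec_nat h (\<lambda>_ g i. wmax A B 0 w g i / K)"
  have g_0: "g 0 = h" and g_Suc: "g (Suc k) = (\<lambda>i. wmax A B 0 w (g k) i / K)" for k
    by (simp_all add: g_def)
  have w0: "0 \<le> w i" for i using w[of i] by simp
  have g0: "0 \<le> g k i" for k i
    by (induction k arbitrary: i) (use h K w in \<open>auto simp: g_0 g_Suc intro!: divide_nonneg_pos wmax_nonneg\<close>)
  have mod: "(\<Sum>i=A..B. w i * g k i powr \<tau> i) \<le> 1" for k
    by (induction k) (use h bdd g0 in \<open>auto simp: g_0 g_Suc\<close>)
  have bound: "g k i \<le> (1 / w i) powr (1 / \<tau> i)" if i: "i \<in> {A..B}" for k i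
  proof -
    have "w i * g k i powr \<tau> i \<le> (\<Sum>i=A..B. w i * g k i powr \<tau> i)"
      using i w0 by (intro member_le_sum) auto
    also note mod
    finally have "g k i powr \<tau> i \<le> 1 / w i" using w[of i] by (simp add: field_simps)
    then have "(g k i powr \<tau> i) powr (1 / \<tau> i) \<le> (1 / w i) powr (1 / \<tau> i)"
      using \<tau>[OF i] by (intro powr_mono2) auto
    then show ?thesis using \<tau>[OF i] g0 by (simp add: powr_powr)
  qed
  have sm: "summable (\<lambda>k. (1/2) ^ k * g k i)" if i: "i \<in> {A..B}" for i
  proof (rule summable_comparison_test)
    show "summable (\<lambda>k. (1/2) ^ k * (1 / w i) powr (1 / \<tau> i))"
      by (intro summable_mult2 summable_geometric) auto
    show "\<exists>N. \<forall>n\<ge>N. norm ((1/2) ^ n * g n i) \<le> (1/2) ^ n * (1 / w i) powr (1 / \<tau> i)"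
      using bound[OF i] g0 by (auto intro!: mult_left_mono simp: abs_mult)
  qed
  define v where "v i = (\<Sum>k. (1/2) ^ k * g k i)" for i
  define u where "u i = (if i \<in> {A..B} then v i else 1)" for i
  have hv: "h i \<le> v i" if i: "i \<in> {A..B}" for i
    using sum_le_suminf[OF sm[OF i], of "{0}"] g0 by (simp add: v_def g_0)
  \<comment> \<open>On the interval \<open>{A..B}\<close> the first iterate is positive everywhere, because \<open>{A..B}\<close> itself competes.\<close>
  have vpos: "0 < v i" if i: "i \<in> {A..B}" for i
  proof -
    have "0 < (\<Sum>i=A..B. h i * w i)"
      using j0 h w0 w[of j0] h(1)[of j0] by (intro sum_pos2[of _ j0]) (auto intro!: mult_pos_pos simp: less_le)
    moreover have "0 < (\<Sum>i=A..B. w i)" using i w by (intro sum_pos) auto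
    ultimately have "0 < (\<Sum>i=A..B. h i * w i) * (\<Sum>i=A..B. w i) powr (0 - 1)" by simp
    also have "\<dots> \<le> wmax A B 0 w h i" using i by (intro wmax_ge) auto
    finally have "0 < g (Suc 0) i" using K by (simp add: g_Suc g_0)
    then show ?thesis
      unfolding v_def using sm[OF i] g0 by (intro suminf_pos2[of _ "Suc 0"]) auto
  qed
  have A1: "wmax A B 0 w u j \<le> 2 * K * u j" if j: "j \<in> {A..B}" for j
  proof (rule wmax_leI)
    fix m n assume mn: "A \<le> m" "m \<le> j" "j \<le> n" "n \<le> B"
    define W where "W = (\<Sum>i=m..n. w i) powr (0 - 1)"
    have sub: "i \<in> {A..B}" if "i \<in> {m..n}" for i using that mn by auto
    have "(\<lambda>k. (\<Sum>i=m..n. (1/2) ^ k * g k i * w i) * W) sums ((\<Sum>i=m..n. v i * w i) * W)"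
      unfolding v_def using sub sm by (intro sums_mult2 sums_sum) (auto intro: summable_sums)
    moreover have "(\<lambda>k. 2 * K * ((1/2) ^ Suc k * g (Suc k) j)) sums (2 * K * (v j - (1/2) ^ 0 * g 0 j))"
      unfolding v_def using summable_sums[OF sm[OF j]]
      by (intro sums_mult, subst sums_Suc_iff[of "\<lambda>k. (1/2) ^ k * g k j"]) simp
    moreover have "(\<Sum>i=m..n. (1/2) ^ k * g k i * w i) * W \<le> 2 * K * ((1/2) ^ Suc k * g (Suc k) j)" for k
    proof -
      have "(\<Sum>i=m..n. (1/2) ^ k * g k i * w i) * W = (1/2) ^ k * ((\<Sum>i=m..n. g k i * w i) * W)"
        by (simp add: sum_distrib_left mult.assoc)
      also have "\<dots> \<le> (1/2) ^ k * wmax A B 0 w (g k) j"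
        unfolding W_def using mn by (intro mult_left_mono wmax_ge) auto
      also have "\<dots> = 2 * K * ((1/2) ^ Suc k * g (Suc k) j)" using K by (simp add: g_Suc)
      finally show ?thesis .
    qed
    ultimately have "(\<Sum>i=m..n. v i * w i) * W \<le> 2 * K * (v j - (1/2) ^ 0 * g 0 j)"
      by (intro sums_le[of _ _ "(\<Sum>i=m..n. v i * w i) * W"]) auto
    also have "\<dots> \<le> 2 * K * v j" using K g0 by (intro mult_left_mono) auto
    finally show "(\<Sum>i=m..n. u i * w i) * (\<Sum>i=m..n. w i) powr (0 - 1) \<le> 2 * K * u j"
      using sub j by (simp add: u_def W_def)
  qed (use j in auto)
  have half: "(\<Sum>k<n. (1/2) ^ Suc k) \<le> (1::real)" for n
  proof -
    have "(\<Sum>k<n. (1/2) ^ Suc k) = 1 - (1/2::real) ^ n" by (induction n) auto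
    then show ?thesis by simp
  qed
  have partial: "(\<Sum>i=A..B. w i * (\<Sum>k<n. (1/2) ^ Suc k * g k i) powr \<tau> i) \<le> 1" for n
  proof -
    have "(\<Sum>i=A..B. w i * (\<Sum>k<n. (1/2) ^ Suc k * g k i) powr \<tau> i)
      \<le> (\<Sum>i=A..B. w i * (\<Sum>k<n. (1/2) ^ Suc k * g k i powr \<tau> i))"
      using w0 g0 half \<tau> by (intro sum_mono mult_left_mono jensen_powr) auto
    also have "\<dots> = (\<Sum>k<n. (1/2) ^ Suc k * (\<Sum>i=A..B. w i * g k i powr \<tau> i))"
      unfolding sum_distrib_left by (subst sum.swap) (simp add: mult_ac)
    also have "\<dots> \<le> (\<Sum>k<n. (1/2) ^ Suc k * 1)"
      by (intro sum_mono mult_left_mono mod) auto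
    also have "\<dots> \<le> 1" using half[of n] by simp
    finally show ?thesis .
  qed
  have "(\<lambda>n. \<Sum>i=A..B. w i * (\<Sum>k<n. (1/2) ^ Suc k * g k i) powr \<tau> i)
      \<longlonglongrightarrow> (\<Sum>i=A..B. w i * (u i / 2) powr \<tau> i)"
  proof (intro tendsto_sum tendsto_mult tendsto_const tendsto_powr)
    fix i assume i: "i \<in> {A..B}"
    have "(\<lambda>k. 1/2 * ((1/2) ^ k * g k i)) sums (1/2 * v i)"
      unfolding v_def using summable_sums[OF sm[OF i]] by (intro sums_mult)
    then show "(\<lambda>n. \<Sum>k<n. (1/2) ^ Suc k * g k i) \<longlonglongrightarrow> u i / 2"
      using i by (simp add: sums_def u_def mult.assoc)
    show "u i / 2 \<noteq> 0" using vpos[OF i] i by (simp add: u_def)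
  qed
  then have "(\<Sum>i=A..B. w i * (u i / 2) powr \<tau> i) \<le> 1"
    by (rule LIMSEQ_le_const2) (use partial in auto)
  then show thesis
    using that[of u] vpos hv A1 by (auto simp: u_def)
qed

text \<open>For an \<open>A\<^sub>1\<close> weight \<open>u\<close> the mean of \<open>u\<close> over an interval is at most \<open>D\<close> times its value at any point
of the interval. Hence \<open>w\<close>-measures of intervals can be exchanged for \<open>u w\<close>-measures.\<close>
lemma A1_interval:
  assumes w: "\<And>i. 0 < w i" and u: "\<And>i. 0 < u i" and D: "0 < D" and \<alpha>: "\<alpha> \<le> 1"
    and A1: "\<And>i. i \<in> {A..B} \<Longrightarrow> wmax A B 0 w u i \<le> D * u i"
    and mn: "A \<le> m" "m \<le> i" "i \<le> n" "n \<le> B"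
  shows "(\<Sum>i=m..n. w i) powr (\<alpha> - 1) \<le> D powr (1 - \<alpha>) * u i powr (1 - \<alpha>) * (\<Sum>i=m..n. u i * w i) powr (\<alpha> - 1)"
proof -
  define W V where "W = (\<Sum>i=m..n. w i)" and "V = (\<Sum>i=m..n. u i * w i)"
  have W: "0 < W" unfolding W_def using mn w by (intro sum_pos) auto
  have V: "0 < V" unfolding V_def using mn w u by (intro sum_pos) auto
  have "V * W powr (0 - 1) \<le> D * u i"
    unfolding V_def W_def using mn by (intro order_trans[OF wmax_ge A1]) auto
  then have "1 / W \<le> D * u i / V" using W V by (simp add: powr_minus field_simps)
  then have "(1 / W) powr (1 - \<alpha>) \<le> (D * u i / V) powr (1 - \<alpha>)"
    using W \<alpha> by (intro powr_mono2) auto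
  moreover have "(1 / W) powr (1 - \<alpha>) = W powr (\<alpha> - 1)" "(1 / V) powr (1 - \<alpha>) = V powr (\<alpha> - 1)"
    using W V by (simp_all add: powr_divide powr_minus_divide[symmetric])
  moreover have "(D * u i / V) powr (1 - \<alpha>) = D powr (1 - \<alpha>) * u i powr (1 - \<alpha>) * (1 / V) powr (1 - \<alpha>)"
    using D u[of i] V by (simp add: powr_mult powr_divide)
  ultimately show ?thesis by (simp add: W_def V_def)
qed

text \<open>The change of measure with the \<open>A\<^sub>1\<close> condition used at the points of summation.\<close>
lemma wmax_A1_inner:
  assumes w: "\<And>i. 0 < w i" and u: "\<And>i. 0 < u i" and D: "0 < D" and \<alpha>: "\<alpha> \<le> 1"
    and A1: "\<And>i. i \<in> {A..B} \<Longrightarrow> wmax A B 0 w u i \<le> D * u i"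
    and f: "\<And>i. 0 \<le> f i" and j: "j \<in> {A..B}"
  shows "wmax A B \<alpha> w f j \<le> D powr (1 - \<alpha>) * wmax A B \<alpha> (\<lambda>i. u i * w i) (\<lambda>i. f i * u i powr (- \<alpha>)) j"
proof (rule wmax_leI)
  fix m n assume mn: "A \<le> m" "m \<le> j" "j \<le> n" "n \<le> B"
  define V where "V = (\<Sum>i=m..n. u i * w i) powr (\<alpha> - 1)"
  have fw0: "0 \<le> f i * w i" and un: "u i \<noteq> 0" for i
    using f[of i] w[of i] u[of i] by simp_all
  have "(\<Sum>i=m..n. f i * w i) * (\<Sum>i=m..n. w i) powr (\<alpha> - 1)
      \<le> (\<Sum>i=m..n. f i * w i * (D powr (1 - \<alpha>) * u i powr (1 - \<alpha>) * V))"
    unfolding sum_distrib_right V_def using assms mn fw0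
    by (intro sum_mono mult_left_mono A1_interval) auto
  also have "\<dots> = D powr (1 - \<alpha>) * ((\<Sum>i=m..n. f i * u i powr (- \<alpha>) * (u i * w i)) * V)"
    unfolding sum_distrib_left sum_distrib_right
  proof (intro sum.cong refl)
    fix i
    have "u i powr (1 - \<alpha>) = u i powr (- \<alpha>) * u i"
      using u[of i] by (simp add: powr_diff powr_minus field_simps)
    then show "f i * w i * (D powr (1 - \<alpha>) * u i powr (1 - \<alpha>) * V)
        = D powr (1 - \<alpha>) * (f i * u i powr (- \<alpha>) * (u i * w i) * V)"
      by (simp only: mult_ac)
  qed
  also have "\<dots> \<le> D powr (1 - \<alpha>) * wmax A B \<alpha> (\<lambda>i. u i * w i) (\<lambda>i. f i * u i powr (- \<alpha>)) j"
    unfolding V_def using mn by (intro mult_left_mono wmax_ge) auto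
  finally show "(\<Sum>i=m..n. f i * w i) * (\<Sum>i=m..n. w i) powr (\<alpha> - 1) \<le> \<dots>" .
qed (use j in auto)

text \<open>The change of measure with the \<open>A\<^sub>1\<close> condition used at the point of evaluation.\<close>
lemma wmax_A1_outer:
  assumes w: "\<And>i. 0 < w i" and u: "\<And>i. 0 < u i" and D: "0 < D" and \<alpha>: "\<alpha> \<le> 1"
    and A1: "\<And>i. i \<in> {A..B} \<Longrightarrow> wmax A B 0 w u i \<le> D * u i"
    and f: "\<And>i. 0 \<le> f i" and j: "j \<in> {A..B}"
  shows "wmax A B \<alpha> w f j \<le> D powr (1 - \<alpha>) * u j powr (1 - \<alpha>) * wmax A B \<alpha> (\<lambda>i. u i * w i) (\<lambda>i. f i / u i) j"
proof (rule wmax_leI)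
  fix m n assume mn: "A \<le> m" "m \<le> j" "j \<le> n" "n \<le> B"
  define V where "V = (\<Sum>i=m..n. u i * w i) powr (\<alpha> - 1)"
  have fw0: "0 \<le> f i * w i" and un: "u i \<noteq> 0" for i
    using f[of i] w[of i] u[of i] by simp_all
  have "(\<Sum>i=m..n. f i * w i) * (\<Sum>i=m..n. w i) powr (\<alpha> - 1)
      \<le> (\<Sum>i=m..n. f i * w i) * (D powr (1 - \<alpha>) * u j powr (1 - \<alpha>) * V)"
    unfolding V_def using assms mn fw0
    by (intro mult_left_mono A1_interval sum_nonneg) auto
  also have "\<dots> = D powr (1 - \<alpha>) * u j powr (1 - \<alpha>) * ((\<Sum>i=m..n. f i / u i * (u i * w i)) * V)"
    using un by simp
  also have "\<dots> \<le> D powr (1 - \<alpha>) * u j powr (1 - \<alpha>) * wmax A B \<alpha> (\<lambda>i. u i * w i) (\<lambda>i. f i / u i) j"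
    unfolding V_def using mn by (intro mult_left_mono wmax_ge) auto
  finally show "(\<Sum>i=m..n. f i * w i) * (\<Sum>i=m..n. w i) powr (\<alpha> - 1) \<le> \<dots>" .
qed (use j in auto)

section \<open>Norms of families of functions\<close>

definition vec_norm :: "real \<Rightarrow> nat \<Rightarrow> (nat \<Rightarrow> int \<Rightarrow> real) \<Rightarrow> int \<Rightarrow> real" where
  "vec_norm \<theta> N f j = (\<Sum>k<N. f k j powr \<theta>) powr (1 / \<theta>)"

lemma vec_norm_nonneg: "0 \<le> vec_norm \<theta> N f j"
  by (simp add: vec_norm_def)

lemma vec_norm_le_mult:
  assumes "0 < \<theta>" "0 \<le> c" and "\<And>k. 0 \<le> f k j" "\<And>k. 0 \<le> g k j"
    and "\<And>k. k < N \<Longrightarrow> f k j \<le> c * g k j"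
  shows "vec_norm \<theta> N f j \<le> c * vec_norm \<theta> N g j"
proof -
  have "vec_norm \<theta> N f j \<le> (\<Sum>k<N. (c * g k j) powr \<theta>) powr (1 / \<theta>)"
    unfolding vec_norm_def using assms by (intro powr_mono2 sum_mono sum_nonneg) auto
  also have "\<dots> = (c powr \<theta> * (\<Sum>k<N. g k j powr \<theta>)) powr (1 / \<theta>)"
    using assms by (simp add: powr_mult sum_distrib_left)
  also have "\<dots> = c * vec_norm \<theta> N g j"
    unfolding vec_norm_def using assms by (subst powr_mult) (auto simp: powr_powr sum_nonneg)
  finally show ?thesis .
qed

lemma vec_norm_mult:
  assumes "0 < \<theta>" "0 \<le> c j" "\<And>k. 0 \<le> f k j"
  shows "vec_norm \<theta> N (\<lambda>k i. f k i * c i) j = vec_norm \<theta> N f j * c j"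
  unfolding vec_norm_def using assms
  by (simp add: powr_mult sum_distrib_right[symmetric] sum_nonneg powr_powr)

text \<open>The constant \<open>D\<close> serves all intervals, all weights and all finite families at once. Uniformity in the
weight is essential: the bound for one value of \<open>\<theta>\<close> at the weight \<open>u w\<close> yields the bound for other
values at the weight \<open>w\<close>.\<close>
definition vector_bound :: "real \<Rightarrow> real \<Rightarrow> real \<Rightarrow> real \<Rightarrow> real \<Rightarrow> bool" where
  "vector_bound \<alpha> \<theta> r s D \<longleftrightarrow> (\<forall>A B w f N. A \<le> B \<longrightarrow> (\<forall>i. 0 < w i) \<longrightarrow> (\<forall>k i. 0 \<le> f k i) \<longrightarrow>
     (\<Sum>i=A..B. w i * vec_norm \<theta> N (\<lambda>k. wmax A B \<alpha> w (f k)) i powr s)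
       \<le> D * (\<Sum>i=A..B. w i * vec_norm \<theta> N f i powr r) powr (s / r))"

text \<open>For \<open>r \<le> \<theta> \<le> s\<close> the scalar estimate can be summed over \<open>k\<close>: Minkowski's inequality moves the
\<open>\<theta>\<close>-norm out of the \<open>s\<close>-norm because \<open>\<theta> \<le> s\<close>, and back into the \<open>r\<close>-norm because \<open>r \<le> \<theta>\<close>.\<close>
lemma vector_bound_between:
  assumes r: "1 < r" and \<alpha>: "0 \<le> \<alpha>" and rs: "1 / r = 1 / s + \<alpha>"
    and \<theta>: "r \<le> \<theta>" "\<theta> \<le> s"
  shows "vector_bound \<alpha> \<theta> r s ((4 * r / (r - 1)) powr r)"
  unfolding vector_bound_def
proof (intro allI impI)
  fix A B :: int and w :: "int \<Rightarrow> real" and f :: "nat \<Rightarrow> int \<Rightarrow> real" and N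
  assume AB: "A \<le> B" and w: "\<forall>i. 0 < w i" and f: "\<forall>k i. 0 \<le> f k i"
  have w0: "0 \<le> w i" for i using w by (simp add: order_less_imp_le)
  have \<theta>0: "0 < \<theta>" and s: "0 < s" using r \<theta> by auto
  define K where "K = (4 * r / (r - 1)) powr r"
  define n where "n k = (\<Sum>i=A..B. w i * f k i powr r)" for k
  have n0: "0 \<le> n k" for k by (auto simp: n_def intro!: sum_nonneg mult_nonneg_nonneg w0)
  have "(\<Sum>i=A..B. w i * vec_norm \<theta> N (\<lambda>k. wmax A B \<alpha> w (f k)) i powr s) powr (\<theta> / s)
     = (\<Sum>i=A..B. w i * (\<Sum>k<N. wmax A B \<alpha> w (f k) i powr \<theta>) powr (s / \<theta>)) powr (1 / (s / \<theta>))"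
    by (simp add: vec_norm_def powr_powr)
  also have "\<dots> \<le> (\<Sum>k<N. (\<Sum>i=A..B. w i * (wmax A B \<alpha> w (f k) i powr \<theta>) powr (s / \<theta>)) powr (1 / (s / \<theta>)))"
    using \<theta> \<theta>0 w0 by (intro minkowski_sum) auto
  also have "\<dots> = (\<Sum>k<N. (\<Sum>i=A..B. w i * wmax A B \<alpha> w (f k) i powr s) powr (\<theta> / s))"
    using \<theta>0 by (simp add: powr_powr)
  also have "\<dots> \<le> (\<Sum>k<N. (K * n k powr (s / r)) powr (\<theta> / s))"
    unfolding K_def n_def using wmax_fractional[OF r s \<alpha> rs AB] w f w0 \<theta>0 s
    by (intro sum_mono powr_mono2) (auto intro!: sum_nonneg mult_nonneg_nonneg)
  also have "\<dots> = K powr (\<theta> / s) * (\<Sum>k<N. n k powr (\<theta> / r))"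
    using s n0 by (simp add: sum_distrib_left powr_mult powr_powr K_def)
  also have "\<dots> \<le> K powr (\<theta> / s) * (\<Sum>i=A..B. w i * vec_norm \<theta> N f i powr r) powr (\<theta> / r)"
  proof (intro mult_left_mono)
    have "(\<Sum>k<N. n k powr (\<theta> / r)) powr (r / \<theta>)
       = (\<Sum>k<N. 1 * (\<Sum>i=A..B. w i * f k i powr r) powr (\<theta> / r)) powr (1 / (\<theta> / r))"
      by (simp add: n_def)
    also have "\<dots> \<le> (\<Sum>i=A..B. (\<Sum>k<N. 1 * (w i * f k i powr r) powr (\<theta> / r)) powr (1 / (\<theta> / r)))"
      using \<theta> \<theta>0 r w0 by (intro minkowski_sum) auto
    also have "\<dots> = (\<Sum>i=A..B. (w i powr (\<theta> / r) * (\<Sum>k<N. f k i powr \<theta>)) powr (r / \<theta>))"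
      using r w0 by (simp add: powr_mult powr_powr sum_distrib_left)
    also have "\<dots> = (\<Sum>i=A..B. w i * vec_norm \<theta> N f i powr r)"
      using r \<theta>0 w0 by (simp add: powr_mult powr_powr sum_nonneg vec_norm_def)
    finally have "((\<Sum>k<N. n k powr (\<theta> / r)) powr (r / \<theta>)) powr (\<theta> / r)
        \<le> (\<Sum>i=A..B. w i * vec_norm \<theta> N f i powr r) powr (\<theta> / r)"
      using r \<theta>0 by (intro powr_mono2) auto
    then show "(\<Sum>k<N. n k powr (\<theta> / r)) \<le> (\<Sum>i=A..B. w i * vec_norm \<theta> N f i powr r) powr (\<theta> / r)"
      using r \<theta>0 by (simp add: powr_powr sum_nonneg)
  qed simp
  finally have "((\<Sum>i=A..B. w i * vec_norm \<theta> N (\<lambda>k. wmax A B \<alpha> w (f k)) i powr s) powr (\<theta> / s)) powr (s / \<theta>)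
     \<le> (K powr (\<theta> / s) * (\<Sum>i=A..B. w i * vec_norm \<theta> N f i powr r) powr (\<theta> / r)) powr (s / \<theta>)"
    using \<theta>0 s by (intro powr_mono2) (auto intro: mult_left_mono)
  then show "(\<Sum>i=A..B. w i * vec_norm \<theta> N (\<lambda>k. wmax A B \<alpha> w (f k)) i powr s)
       \<le> K * (\<Sum>i=A..B. w i * vec_norm \<theta> N f i powr r) powr (s / r)"
    using \<theta>0 s w0 by (simp add: powr_powr powr_mult sum_nonneg K_def)
qed

text \<open>Since \<open>r / s = 1 - \<alpha> r\<close>, the factor \<open>u powr (- \<alpha>)\<close> from the change of measure produces exactly the
weight \<open>u powr (r / s)\<close> of off-diagonal extrapolation.\<close>
lemma vector_bound_A1_weight:
  assumes vb: "vector_bound \<alpha> \<theta> r s D" and r: "0 < r" and s: "0 < s" and \<theta>: "0 < \<theta>" and rs: "1 / r = 1 / s + \<alpha>"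
    and \<alpha>: "\<alpha> \<le> 1" and AB: "A \<le> B" and w: "\<And>i. 0 < w i" and u: "\<And>i. 0 < u i" and E: "0 < E"
    and A1: "\<And>i. i \<in> {A..B} \<Longrightarrow> wmax A B 0 w u i \<le> E * u i"
    and f: "\<And>k i. 0 \<le> f k i"
  shows "(\<Sum>i=A..B. w i * (vec_norm \<theta> N (\<lambda>k. wmax A B \<alpha> w (f k)) i powr s * u i))
    \<le> E powr ((1 - \<alpha>) * s) * D * (\<Sum>i=A..B. w i * (vec_norm \<theta> N f i powr r * u i powr (r / s))) powr (s / r)"
proof -
  define g where "g k i = f k i * u i powr (- \<alpha>)" for k i
  have g0: "0 \<le> g k i" for k i using f by (simp add: g_def)
  have uw: "0 < u i * w i" for i using u[of i] w[of i] by simp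
  have "(\<Sum>i=A..B. w i * (vec_norm \<theta> N (\<lambda>k. wmax A B \<alpha> w (f k)) i powr s * u i))
    \<le> (\<Sum>i=A..B. (u i * w i) * (E powr ((1 - \<alpha>) * s) * vec_norm \<theta> N (\<lambda>k. wmax A B \<alpha> (\<lambda>i. u i * w i) (g k)) i powr s))"
  proof (intro sum_mono)
    fix i assume i: "i \<in> {A..B}"
    have "vec_norm \<theta> N (\<lambda>k. wmax A B \<alpha> w (f k)) i \<le> E powr (1 - \<alpha>) * vec_norm \<theta> N (\<lambda>k. wmax A B \<alpha> (\<lambda>i. u i * w i) (g k)) i"
      unfolding g_def using assms i uw
      by (intro vec_norm_le_mult wmax_nonneg wmax_A1_inner) auto
    then have "vec_norm \<theta> N (\<lambda>k. wmax A B \<alpha> w (f k)) i powr s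
        \<le> (E powr (1 - \<alpha>) * vec_norm \<theta> N (\<lambda>k. wmax A B \<alpha> (\<lambda>i. u i * w i) (g k)) i) powr s"
      using s by (intro powr_mono2) (auto simp: vec_norm_nonneg)
    also have "\<dots> = E powr ((1 - \<alpha>) * s) * vec_norm \<theta> N (\<lambda>k. wmax A B \<alpha> (\<lambda>i. u i * w i) (g k)) i powr s"
      by (simp add: powr_mult powr_powr vec_norm_nonneg)
    finally have "u i * w i * vec_norm \<theta> N (\<lambda>k. wmax A B \<alpha> w (f k)) i powr s
        \<le> u i * w i * (E powr ((1 - \<alpha>) * s) * vec_norm \<theta> N (\<lambda>k. wmax A B \<alpha> (\<lambda>i. u i * w i) (g k)) i powr s)"
      using uw[of i] by (intro mult_left_mono) auto
    then show "w i * (vec_norm \<theta> N (\<lambda>k. wmax A B \<alpha> w (f k)) i powr s * u i)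
        \<le> (u i * w i) * (E powr ((1 - \<alpha>) * s) * vec_norm \<theta> N (\<lambda>k. wmax A B \<alpha> (\<lambda>i. u i * w i) (g k)) i powr s)"
      by (simp only: mult_ac)
  qed
  also have "\<dots> = E powr ((1 - \<alpha>) * s) * (\<Sum>i=A..B. (u i * w i) * vec_norm \<theta> N (\<lambda>k. wmax A B \<alpha> (\<lambda>i. u i * w i) (g k)) i powr s)"
    by (simp add: sum_distrib_left mult_ac)
  also have "\<dots> \<le> E powr ((1 - \<alpha>) * s) * (D * (\<Sum>i=A..B. (u i * w i) * vec_norm \<theta> N g i powr r) powr (s / r))"
    using vb AB uw g0 unfolding vector_bound_def by (intro mult_left_mono) auto
  also have "(\<Sum>i=A..B. (u i * w i) * vec_norm \<theta> N g i powr r) = (\<Sum>i=A..B. w i * (vec_norm \<theta> N f i powr r * u i powr (r / s)))"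
  proof (intro sum.cong refl)
    fix i
    have "vec_norm \<theta> N g i = vec_norm \<theta> N f i * u i powr (- \<alpha>)"
      unfolding g_def using \<theta> f by (intro vec_norm_mult) auto
    then have "u i * vec_norm \<theta> N g i powr r = vec_norm \<theta> N f i powr r * (u i powr 1 * u i powr (- \<alpha> * r))"
      using u[of i] by (simp add: powr_mult powr_powr vec_norm_nonneg)
    also have "u i powr 1 * u i powr (- \<alpha> * r) = u i powr (r / s)"
    proof -
      have "1 + - \<alpha> * r = r / s" using rs r s by (simp add: field_simps)
      then show ?thesis by (simp only: powr_add[symmetric])
    qed
    finally have "w i * (u i * vec_norm \<theta> N g i powr r) = w i * (vec_norm \<theta> N f i powr r * u i powr (r / s))"
      by simp
    then show "(u i * w i) * vec_norm \<theta> N g i powr r = w i * (vec_norm \<theta> N f i powr r * u i powr (r / s))"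
      by (simp only: mult_ac)
  qed
  finally show ?thesis by (simp add: mult.assoc)
qed

section \<open>Extrapolation\<close>

text \<open>Extrapolation from a weighted estimate at the constant exponents \<open>r, s\<close> to the exponents \<open>p, q\<close>.
If the modular of \<open>F / C\<close> exceeded 1, some \<open>f = F / (C l)\<close> with \<open>l > 1\<close> would have modular equal to 1.
Then \<open>h = f powr (q - s)\<close> has modular 1 for the exponent \<open>\<tau> = q / (q - s)\<close>, the conjugate of \<open>q / s\<close>, and
realises the duality pairing with \<open>f powr s\<close>. Replacing \<open>h\<close> by its \<open>A\<^sub>1\<close> majorant \<open>u\<close>, applying the weighted
estimate, and separating \<open>G\<close> from \<open>u\<close> by Young's inequality forces \<open>l \<le> 1\<close>.\<close>
lemma off_diagonal_extrapolation:
  fixes p q F G w :: "int \<Rightarrow> real"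
  assumes w: "\<And>i. 0 < w i" and s: "0 < s" and r: "0 < r" and \<alpha>: "0 \<le> \<alpha>" and rs: "1 / r = 1 / s + \<alpha>"
    and q: "\<And>i. s < q i" and p: "\<And>i. 1 / p i = 1 / q i + \<alpha>" and K: "0 < K" and D: "0 < D"
    and bdd: "\<And>h. (\<And>i. 0 \<le> h i) \<Longrightarrow> (\<Sum>i=A..B. w i * h i powr (q i / (q i - s))) \<le> 1 \<Longrightarrow>
      (\<Sum>i=A..B. w i * (wmax A B 0 w h i / K) powr (q i / (q i - s))) \<le> 1"
    and F: "\<And>i. 0 \<le> F i" and G: "\<And>i. 0 \<le> G i" "(\<Sum>i=A..B. w i * G i powr p i) \<le> 1"
    and base: "\<And>u. (\<And>i. 0 < u i) \<Longrightarrow> (\<And>i. i \<in> {A..B} \<Longrightarrow> wmax A B 0 w u i \<le> 2 * K * u i) \<Longrightarrow>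
      (\<Sum>i=A..B. w i * (F i powr s * u i)) \<le> D * (\<Sum>i=A..B. w i * (G i powr r * u i powr (r / s))) powr (s / r)"
  shows "(\<Sum>i=A..B. w i * (F i / (D * 2 powr (s / r) * 2) powr (1 / s)) powr q i) \<le> 1"
proof (rule ccontr)
  define C where "C = (D * 2 powr (s / r) * 2) powr (1 / s)"
  define \<tau> where "\<tau> i = q i / (q i - s)" for i
  define \<phi> where "\<phi> l = (\<Sum>i=A..B. w i * (F i / (C * l)) powr q i)" for l
  have w0: "0 \<le> w i" for i using w[of i] by simp
  have C: "0 < C" "C powr s = D * 2 powr (s / r) * 2" using D s by (auto simp: C_def powr_powr)
  assume "\<not> (\<Sum>i=A..B. w i * (F i / (D * 2 powr (s / r) * 2) powr (1 / s)) powr q i) \<le> 1"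
  then have Z: "1 < \<phi> 1" by (simp add: \<phi>_def C_def)
  \<comment> \<open>All exponents \<open>q i\<close> exceed \<open>s\<close>, so dividing by \<open>L\<close> lowers the modular to at most 1.\<close>
  define L where "L = \<phi> 1 powr (1 / s)"
  have L: "1 \<le> L" using Z s by (simp add: L_def ge_one_powr_ge_zero)
  have "\<phi> L \<le> (\<Sum>i=A..B. L powr (- s) * (w i * (F i / C) powr q i))"
    unfolding \<phi>_def
  proof (intro sum_mono)
    fix i
    have "(F i / (C * L)) powr q i = (F i / C) powr q i * L powr (- q i)"
      using F[of i] C L by (simp add: powr_divide powr_mult powr_minus field_simps)
    also have "\<dots> \<le> (F i / C) powr q i * L powr (- s)"
      using L q[of i] by (intro mult_left_mono powr_mono) auto
    finally show "w i * (F i / (C * L)) powr q i \<le> L powr (- s) * (w i * (F i / C) powr q i)"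
      using w[of i] by (simp add: mult_ac)
  qed
  also have "\<dots> = L powr (- s) * \<phi> 1" by (simp add: \<phi>_def sum_distrib_left)
  also have "\<dots> = 1" using Z s by (simp add: L_def powr_powr powr_minus)
  finally have L1: "\<phi> L \<le> 1" .
  have "continuous_on {1..L} \<phi>"
    unfolding \<phi>_def
    by (intro continuous_on_sum continuous_on_mult continuous_on_const continuous_on_powr' continuous_on_divide
        continuous_on_id) (use C F less_trans[OF s q] in auto)
  then obtain l where l: "1 \<le> l" "l \<le> L" "\<phi> l = 1"
    using IVT2'[of \<phi> L 1 1] L1 Z L by auto
  have l1: "1 < l" using l Z by (cases "l = 1") auto
  define f where "f i = F i / (C * l)" for i
  have f0: "0 \<le> f i" for i using F C l by (simp add: f_def)
  have fq: "(\<Sum>i=A..B. w i * f i powr q i) = 1" using l by (simp add: \<phi>_def f_def)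
  define h where "h i = f i powr (q i - s)" for i
  have h\<tau>: "h i powr \<tau> i = f i powr q i" for i
    using q[of i] by (simp add: h_def \<tau>_def powr_powr)
  obtain j0 where j0: "j0 \<in> {A..B}" "f j0 \<noteq> 0"
  proof (rule ccontr)
    assume "\<not> thesis"
    then have "f i = 0" if "i \<in> {A..B}" for i using that \<open>\<And>j0. j0 \<in> {A..B} \<Longrightarrow> f j0 \<noteq> 0 \<Longrightarrow> thesis\<close> by blast
    then have "(\<Sum>i=A..B. w i * f i powr q i) = 0" by (intro sum.neutral) auto
    then show False using fq by simp
  qed
  have \<tau>1: "1 \<le> \<tau> i" for i using q[of i] s by (simp add: \<tau>_def field_simps)
  have hm: "(\<Sum>i=A..B. w i * h i powr \<tau> i) \<le> 1" using fq by (simp add: h\<tau>)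
  obtain u where u: "\<And>i. 0 < u i" "\<And>i. i \<in> {A..B} \<Longrightarrow> h i \<le> u i"
    "\<And>i. i \<in> {A..B} \<Longrightarrow> wmax A B 0 w u i \<le> 2 * K * u i"
    "(\<Sum>i=A..B. w i * (u i / 2) powr \<tau> i) \<le> 1"
    by (rule rubio_de_francia[of w A B \<tau> K h j0]) (use w \<tau>1 K bdd hm j0 in \<open>auto simp: h_def \<tau>_def\<close>)
  have "1 = (\<Sum>i=A..B. w i * f i powr q i)" using fq by simp
  also have "\<dots> = (\<Sum>i=A..B. w i * (f i powr s * h i))"
    by (simp add: h_def flip: powr_add)
  also have "\<dots> \<le> (\<Sum>i=A..B. w i * (f i powr s * u i))"
    using u w0 by (intro sum_mono mult_left_mono) auto
  also have "\<dots> = (C * l) powr (- s) * (\<Sum>i=A..B. w i * (F i powr s * u i))"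
    using F C l by (simp add: f_def powr_divide powr_minus sum_distrib_left field_simps)
  also have "\<dots> \<le> (C * l) powr (- s) * (D * (\<Sum>i=A..B. w i * (G i powr r * u i powr (r / s))) powr (s / r))"
    using u by (intro mult_left_mono base) auto
  also have "(\<Sum>i=A..B. w i * (G i powr r * u i powr (r / s))) \<le> 2 * 2 powr (r / s)"
  proof -
    \<comment> \<open>The exponents match because \<open>\<tau> (1 - r / p) = r / s\<close>.\<close>
    have pt: "G i powr r * u i powr (r / s) \<le> 2 powr (r / s) * (G i powr p i + (u i / 2) powr \<tau> i)" for i
    proof -
      have q0: "0 < q i" using q[of i] s by linarith
      have "0 < 1 / p i" using p[of i] q0 \<alpha> by (simp add: add_pos_nonneg)
      then have p0: "0 < p i" by simp
      have "1 / q i \<le> 1 / s" using q[of i] s by (simp add: frac_le)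
      then have "1 / p i \<le> 1 / r" using p[of i] rs by simp
      then have rp: "r / p i \<le> 1" using r p0 by (simp add: field_simps)
      have "1 - r / p i = r * (1 / r - 1 / p i)" using r by (simp add: field_simps)
      also have "\<dots> = r * (1 / s - 1 / q i)" using p[of i] rs by simp
      finally have e: "\<tau> i * (1 - r / p i) = r / s"
        using q[of i] q0 s by (simp add: \<tau>_def field_simps)
      have "G i powr r * (u i / 2) powr (r / s) = (G i powr p i) powr (r / p i) * ((u i / 2) powr \<tau> i) powr (1 - r / p i)"
        using p0 by (simp add: powr_powr e)
      also have "\<dots> \<le> G i powr p i + (u i / 2) powr \<tau> i"
        using rp r p0 by (intro young_sum) auto
      finally show ?thesis
        using u(1)[of i] by (simp add: powr_divide field_simps)
    qed
    have "(\<Sum>i=A..B. w i * (G i powr r * u i powr (r / s)))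
       \<le> (\<Sum>i=A..B. w i * (2 powr (r / s) * (G i powr p i + (u i / 2) powr \<tau> i)))"
      by (intro sum_mono mult_left_mono pt w0)
    also have "\<dots> = 2 powr (r / s) * ((\<Sum>i=A..B. w i * G i powr p i) + (\<Sum>i=A..B. w i * (u i / 2) powr \<tau> i))"
      by (simp add: sum_distrib_left sum.distrib algebra_simps)
    also have "\<dots> \<le> 2 powr (r / s) * (1 + 1)"
      using G u by (intro mult_left_mono add_mono) auto
    finally show ?thesis by simp
  qed
  then have "(C * l) powr (- s) * (D * (\<Sum>i=A..B. w i * (G i powr r * u i powr (r / s))) powr (s / r))
      \<le> (C * l) powr (- s) * (D * (2 * 2 powr (r / s)) powr (s / r))"
    using D s r w0 by (intro mult_left_mono powr_mono2 sum_nonneg) auto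
  also have "(2 * 2 powr (r / s)) powr (s / r) = 2 powr (s / r) * (2::real)"
    using s r by (simp add: powr_mult powr_powr)
  also have "(C * l) powr (- s) * (D * (2 powr (s / r) * 2)) = l powr (- s)"
  proof -
    have "(C * l) powr (- s) = C powr (- s) * l powr (- s)"
      using C l by (simp add: powr_mult)
    moreover have "C powr (- s) = 1 / (D * 2 powr (s / r) * 2)"
      by (simp only: powr_minus_divide C(2))
    ultimately show ?thesis using D by simp
  qed
  also have "\<dots> < 1" using l1 s by (simp add: powr_less_one powr_minus inverse_less_1_iff)
  finally show False by simp
qed

text \<open>Both sides are homogeneous in \<open>f\<close>, so the \<open>r\<close>-norm on the right may be taken to be 1.\<close>
lemma vector_bound_normalized:
  assumes r: "0 < r" and s: "0 < s" and \<theta>: "0 < \<theta>" and D: "0 \<le> D"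
    and nb: "\<And>A B w f N. A \<le> B \<Longrightarrow> (\<And>i. 0 < w i) \<Longrightarrow> (\<And>k i. 0 \<le> f k i) \<Longrightarrow>
      (\<Sum>i=A..B. w i * vec_norm \<theta> N f i powr r) = 1 \<Longrightarrow>
      (\<Sum>i=A..B. w i * vec_norm \<theta> N (\<lambda>k. wmax A B \<alpha> w (f k)) i powr s) \<le> D"
  shows "vector_bound \<alpha> \<theta> r s D"
  unfolding vector_bound_def
proof (intro allI impI)
  fix A B :: int and w :: "int \<Rightarrow> real" and f :: "nat \<Rightarrow> int \<Rightarrow> real" and N
  assume AB: "A \<le> B" and w: "\<forall>i. 0 < w i" and f: "\<forall>k i. 0 \<le> f k i"
  have w0: "0 \<le> w i" for i using w by (simp add: order_less_imp_le)
  define n where "n = (\<Sum>i=A..B. w i * vec_norm \<theta> N f i powr r)"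
  define F where "F i = vec_norm \<theta> N (\<lambda>k. wmax A B \<alpha> w (f k)) i" for i
  have n0: "0 \<le> n" unfolding n_def by (intro sum_nonneg mult_nonneg_nonneg w0) auto
  have "(\<Sum>i=A..B. w i * F i powr s) \<le> D * n powr (s / r)"
  proof (cases "n = 0")
    case True
    have f_0: "f k i = 0" if i: "i \<in> {A..B}" and k: "k < N" for i k
    proof -
      have "w i * vec_norm \<theta> N f i powr r = 0"
        using True i w0 unfolding n_def by (subst (asm) sum_nonneg_eq_0_iff) auto
      then have "vec_norm \<theta> N f i = 0" using w[rule_format, of i] by simp
      then have "(\<Sum>k<N. f k i powr \<theta>) = 0" by (simp add: vec_norm_def)
      then have "f k i powr \<theta> = 0" using k by (subst (asm) sum_nonneg_eq_0_iff) auto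
      then show ?thesis by simp
    qed
    have "wmax A B \<alpha> w (f k) i = 0" if i: "i \<in> {A..B}" and k: "k < N" for i k
    proof (rule antisym)
      show "wmax A B \<alpha> w (f k) i \<le> 0"
      proof (rule wmax_leI)
        fix m n assume "A \<le> m" "n \<le> B"
        then have "(\<Sum>i=m..n. f k i * w i) = 0" using f_0 k by (intro sum.neutral) auto
        then show "(\<Sum>i=m..n. f k i * w i) * (\<Sum>i=m..n. w i) powr (\<alpha> - 1) \<le> 0" by simp
      qed (use i in auto)
      show "0 \<le> wmax A B \<alpha> w (f k) i" using w f by (intro wmax_nonneg) auto
    qed
    then have "F i = 0" if "i \<in> {A..B}" for i using that by (simp add: F_def vec_norm_def)
    then have "(\<Sum>i=A..B. w i * F i powr s) = 0" by (intro sum.neutral) auto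
    then show ?thesis using True by simp
  next
    case False
    then have n: "0 < n" using n0 by simp
    define c where "c = n powr (- (1 / r))"
    have c: "0 < c" "c powr r = 1 / n" "c powr s = n powr (- (s / r))"
      using n r by (auto simp: c_def powr_powr powr_neg_one)
    define g where "g k i = f k i * c" for k i
    have g0: "0 \<le> g k i" for k i using f c by (simp add: g_def)
    have eg: "vec_norm \<theta> N g i = vec_norm \<theta> N f i * c" for i
      unfolding g_def using \<theta> c f by (intro vec_norm_mult) auto
    have Fg: "F i * c \<le> vec_norm \<theta> N (\<lambda>k. wmax A B \<alpha> w (g k)) i" if i: "i \<in> {A..B}" for i
    proof -
      have "F i \<le> (1 / c) * vec_norm \<theta> N (\<lambda>k. wmax A B \<alpha> w (g k)) i"
        unfolding F_def
      proof (rule vec_norm_le_mult)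
        fix k
        show "wmax A B \<alpha> w (f k) i \<le> 1 / c * wmax A B \<alpha> w (g k) i"
          unfolding g_def using c i by (intro wmax_scale) auto
      qed (use \<theta> c w f g0 in \<open>auto intro!: wmax_nonneg\<close>)
      then show ?thesis using c by (simp add: field_simps)
    qed
    have "(\<Sum>i=A..B. w i * vec_norm \<theta> N g i powr r) = (\<Sum>i=A..B. w i * vec_norm \<theta> N f i powr r) / n"
      using c by (simp add: eg powr_mult vec_norm_nonneg sum_divide_distrib)
    then have "(\<Sum>i=A..B. w i * vec_norm \<theta> N g i powr r) = 1" using n by (simp add: n_def)
    then have "(\<Sum>i=A..B. w i * vec_norm \<theta> N (\<lambda>k. wmax A B \<alpha> w (g k)) i powr s) \<le> D"
      using AB w g0 by (intro nb) auto
    moreover have "(\<Sum>i=A..B. w i * (F i * c) powr s) \<le> (\<Sum>i=A..B. w i * vec_norm \<theta> N (\<lambda>k. wmax A B \<alpha> w (g k)) i powr s)"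
      using Fg w0 s c by (intro sum_mono mult_left_mono powr_mono2) (auto simp: F_def vec_norm_nonneg)
    moreover have "(\<Sum>i=A..B. w i * (F i * c) powr s) = n powr (- (s / r)) * (\<Sum>i=A..B. w i * F i powr s)"
      using c by (simp add: powr_mult F_def vec_norm_nonneg sum_distrib_left mult_ac)
    ultimately have "n powr (- (s / r)) * (\<Sum>i=A..B. w i * F i powr s) \<le> D" by linarith
    then show ?thesis using n by (simp add: powr_minus field_simps)
  qed
  then show "(\<Sum>i=A..B. w i * vec_norm \<theta> N (\<lambda>k. wmax A B \<alpha> w (f k)) i powr s)
       \<le> D * (\<Sum>i=A..B. w i * vec_norm \<theta> N f i powr r) powr (s / r)"
    by (simp add: F_def n_def)
qed

text \<open>For \<open>\<theta> < r\<close>, the case \<open>r \<le> \<theta> \<le> s\<close> already done is available at the exponents \<open>\<theta>, t\<close> with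
\<open>1 / t = 1 / \<theta> - \<alpha>\<close>. Extrapolation with constant exponents goes up from there to \<open>r, s\<close>; the maximal
bound it needs holds at every exponent above 1.\<close>
lemma vector_bound_below:
  assumes \<theta>: "1 < \<theta>" "\<theta> < r" and s: "0 < s" and \<alpha>: "0 \<le> \<alpha>" "\<alpha> < 1" and rs: "1 / r = 1 / s + \<alpha>"
  shows "\<exists>D. 0 < D \<and> vector_bound \<alpha> \<theta> r s D"
proof -
  define t where "t = 1 / (1 / \<theta> - \<alpha>)"
  have "1 / r < 1 / \<theta>" using \<theta> by (simp add: frac_less2)
  then have lt: "1 / s < 1 / \<theta> - \<alpha>" using rs by simp
  then have pos: "0 < 1 / \<theta> - \<alpha>" using s by (smt (verit) zero_less_divide_1_iff)
  then have t: "0 < t" "1 / \<theta> = 1 / t + \<alpha>" by (auto simp: t_def)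
  have "1 / t \<le> 1 / \<theta>" using t \<alpha> by simp
  then have \<theta>t: "\<theta> \<le> t" using t(1) \<theta>(1) by (simp add: field_simps)
  have ts: "t < s" using lt t s by (simp add: field_simps)
  define E where "E = (4 * \<theta> / (\<theta> - 1)) powr \<theta>"
  have vb: "vector_bound \<alpha> \<theta> \<theta> t E"
    unfolding E_def using \<theta> \<alpha> t \<theta>t by (intro vector_bound_between) auto
  define \<tau> where "\<tau> = s / (s - t)"
  have \<tau>: "1 < \<tau>" using t ts by (simp add: \<tau>_def field_simps)
  define K where "K = 4 * \<tau> / (\<tau> - 1)"
  have K: "0 < K" using \<tau> by (simp add: K_def)
  define D where "D = (2 * K) powr ((1 - \<alpha>) * t) * E"
  have D: "0 < D" using K \<theta> by (simp add: D_def E_def)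
  define C where "C = (D * 2 powr (t / \<theta>) * 2) powr (1 / t)"
  have C: "0 < C" using D by (simp add: C_def)
  have "vector_bound \<alpha> \<theta> r s (C powr s)"
  proof (rule vector_bound_normalized)
    fix A B :: int and w :: "int \<Rightarrow> real" and f :: "nat \<Rightarrow> int \<Rightarrow> real" and N
    assume AB: "A \<le> B" and w: "\<And>i. 0 < w i" and f: "\<And>k i. 0 \<le> f k i"
      and n: "(\<Sum>i=A..B. w i * vec_norm \<theta> N f i powr r) = 1"
    have "(\<Sum>i=A..B. w i * (vec_norm \<theta> N (\<lambda>k. wmax A B \<alpha> w (f k)) i / C) powr s) \<le> 1"
      unfolding C_def
    proof (rule off_diagonal_extrapolation[where q = "\<lambda>_. s" and p = "\<lambda>_. r" and r = \<theta> and s = t and K = K and \<alpha> = \<alpha> and G = "vec_norm \<theta> N f"])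
      show "(\<Sum>i=A..B. w i * (wmax A B 0 w h i / K) powr (s / (s - t))) \<le> 1"
        if "\<And>i. 0 \<le> h i" "(\<Sum>i=A..B. w i * h i powr (s / (s - t))) \<le> 1" for h
        unfolding K_def using wmax_strong_modular[OF \<tau> w that(1)] that(2) by (simp add: \<tau>_def)
      show "(\<Sum>i=A..B. w i * (vec_norm \<theta> N (\<lambda>k. wmax A B \<alpha> w (f k)) i powr t * u i))
        \<le> D * (\<Sum>i=A..B. w i * (vec_norm \<theta> N f i powr \<theta> * u i powr (\<theta> / t))) powr (t / \<theta>)"
        if "\<And>i. 0 < u i" "\<And>i. i \<in> {A..B} \<Longrightarrow> wmax A B 0 w u i \<le> 2 * K * u i" for u
        unfolding D_def using vb \<theta> t \<alpha> AB w K that f by (intro vector_bound_A1_weight) auto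
    qed (use w t \<theta> \<alpha> ts rs K D n in \<open>auto simp: vec_norm_nonneg\<close>)
    moreover have "(\<Sum>i=A..B. w i * (vec_norm \<theta> N (\<lambda>k. wmax A B \<alpha> w (f k)) i / C) powr s)
       = (\<Sum>i=A..B. w i * vec_norm \<theta> N (\<lambda>k. wmax A B \<alpha> w (f k)) i powr s) / C powr s"
      using C by (simp add: powr_divide vec_norm_nonneg sum_divide_distrib)
    ultimately show "(\<Sum>i=A..B. w i * vec_norm \<theta> N (\<lambda>k. wmax A B \<alpha> w (f k)) i powr s) \<le> C powr s"
      using C by (simp add: field_simps)
  qed (use \<theta> s in auto)
  then show ?thesis using C by (intro exI[of _ "C powr s"]) auto
qed

text \<open>For \<open>s < \<theta>\<close>, extrapolation goes down from the exponents \<open>t, \<theta>\<close> with \<open>1 / t = 1 / \<theta> + \<alpha>\<close>. The weight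
\<open>u\<close> now is an \<open>A\<^sub>1\<close> majorant of the power \<open>h\<close> of \<open>G\<close> whose \<open>e\<close>-th power is \<open>G\<^sup>r\<close>, and it enters with a
negative exponent: since \<open>u\<close> is at least \<open>h\<close>, the \<open>t\<close>-norm of \<open>G\<close> with this weight is controlled by the
\<open>r\<close>-norm of \<open>G\<close>. The exponent \<open>e\<close> is fixed by Young's inequality in the last step, and \<open>e > 1\<close> expresses \<open>r > 1\<close>.\<close>
lemma vector_bound_above:
  assumes r: "1 < r" and s: "0 < s" "s < \<theta>" and \<alpha>: "0 \<le> \<alpha>" "\<alpha> < 1" and rs: "1 / r = 1 / s + \<alpha>"
  shows "\<exists>D. 0 < D \<and> vector_bound \<alpha> \<theta> r s D"
proof -
  define t where "t = 1 / (1 / \<theta> + \<alpha>)"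
  have \<theta>: "0 < \<theta>" using s by simp
  have t0: "0 < t" using \<theta> \<alpha> by (auto simp: t_def intro!: add_pos_nonneg divide_pos_pos)
  have t: "1 / t = 1 / \<theta> + \<alpha>" by (simp add: t_def)
  have lt: "1 / \<theta> < 1 / s" using s by (simp add: frac_less2)
  then have tr: "1 / t < 1 / r" using t rs by simp
  then have rt: "r < t" using t0 r by (simp add: field_simps)
  have "1 / \<theta> \<le> 1 / t" using t \<alpha> by simp
  then have t\<theta>: "t \<le> \<theta>" using t0 \<theta> by (simp add: field_simps)
  define E where "E = (4 * t / (t - 1)) powr t"
  have vb: "vector_bound \<alpha> \<theta> t \<theta> E"
    unfolding E_def using r rt t \<alpha> t\<theta> by (intro vector_bound_between) auto
  define e where "e = (1 - 1 / t) / (1 / s - 1 / \<theta>)"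
  have "1 / s - 1 / \<theta> = 1 / r - 1 / t" using t rs by simp
  moreover have "1 / r < 1" using r by simp
  ultimately have "0 < 1 / s - 1 / \<theta>" "1 / s - 1 / \<theta> < 1 - 1 / t" using lt by linarith+
  then have e1: "1 < e" unfolding e_def by (subst less_divide_eq_1_pos)
  define K where "K = 4 * e / (e - 1)"
  have K: "0 < K" using e1 by (simp add: K_def)
  define D where "D = (2 * K) powr ((1 - \<alpha>) * \<theta>) * E + 2 powr e"
  have D: "0 < D" using K r rt by (simp add: D_def E_def add_pos_nonneg)
  have "vector_bound \<alpha> \<theta> r s D"
  proof (rule vector_bound_normalized)
    fix A B :: int and w :: "int \<Rightarrow> real" and f :: "nat \<Rightarrow> int \<Rightarrow> real" and N
    assume AB: "A \<le> B" and w: "\<And>i. 0 < w i" and f: "\<And>k i. 0 \<le> f k i"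
      and n: "(\<Sum>i=A..B. w i * vec_norm \<theta> N f i powr r) = 1"
    have w0: "0 \<le> w i" for i using w[of i] by simp
    define G where "G = vec_norm \<theta> N f"
    define F where "F = vec_norm \<theta> N (\<lambda>k. wmax A B \<alpha> w (f k))"
    have G0: "0 \<le> G i" and F0: "0 \<le> F i" for i by (simp_all add: G_def F_def vec_norm_nonneg)
    define h where "h i = G i powr (r / e)" for i
    have "(\<Sum>i=A..B. w i * h i powr e) = 1" using n e1 by (simp add: h_def powr_powr G_def)
    moreover obtain j0 where "j0 \<in> {A..B}" "h j0 \<noteq> 0"
    proof (rule ccontr)
      assume "\<not> thesis"
      then have "h i powr e = 0" if "i \<in> {A..B}" for i
        using that \<open>\<And>j0. j0 \<in> {A..B} \<Longrightarrow> h j0 \<noteq> 0 \<Longrightarrow> thesis\<close> by auto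
      then have "(\<Sum>i=A..B. w i * h i powr e) = 0" by (intro sum.neutral) auto
      then show False using \<open>(\<Sum>i=A..B. w i * h i powr e) = 1\<close> by simp
    qed
    ultimately obtain u where u: "\<And>i. 0 < u i" "\<And>i. i \<in> {A..B} \<Longrightarrow> h i \<le> u i"
      "\<And>i. i \<in> {A..B} \<Longrightarrow> wmax A B 0 w u i \<le> 2 * K * u i"
      "(\<Sum>i=A..B. w i * (u i / 2) powr e) \<le> 1"
      using rubio_de_francia[of w A B "\<lambda>_. e" K h j0] w e1 K wmax_strong_modular[OF e1 w]
      by (auto simp: h_def K_def)
    define v where "v i = u i * w i" for i
    define g where "g k i = f k i * (1 / u i)" for k i
    define H where "H = vec_norm \<theta> N (\<lambda>k. wmax A B \<alpha> v (g k))"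
    have v: "0 < v i" for i using u(1)[of i] w[of i] by (simp add: v_def)
    have g0: "0 \<le> g k i" for k i using f u(1)[of i] by (simp add: g_def)
    have H0: "0 \<le> H i" for i by (simp add: H_def vec_norm_nonneg)
    have FH: "F i \<le> (2 * K) powr (1 - \<alpha>) * u i powr (1 - \<alpha>) * H i" if i: "i \<in> {A..B}" for i
      unfolding F_def H_def
    proof (rule vec_norm_le_mult)
      show "wmax A B \<alpha> w (f k) i \<le> (2 * K) powr (1 - \<alpha>) * u i powr (1 - \<alpha>) * wmax A B \<alpha> v (g k) i" for k
        unfolding v_def g_def using wmax_A1_outer[of w u "2 * K" \<alpha> A B "f k" i] w u K \<alpha> f i by simp
    qed (use \<theta> w f v g0 in \<open>auto intro!: wmax_nonneg\<close>)
    have "(\<Sum>i=A..B. v i * H i powr \<theta>) \<le> E * (\<Sum>i=A..B. v i * vec_norm \<theta> N g i powr t) powr (\<theta> / t)"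
      using vb AB v g0 unfolding vector_bound_def H_def by auto
    also have "\<dots> \<le> E * 1 powr (\<theta> / t)"
    proof (intro mult_left_mono powr_mono2)
      have "(\<Sum>i=A..B. v i * vec_norm \<theta> N g i powr t) \<le> (\<Sum>i=A..B. w i * G i powr r)"
      proof (intro sum_mono)
        fix i assume i: "i \<in> {A..B}"
        have "vec_norm \<theta> N g i = G i * (1 / u i)"
          unfolding g_def G_def using \<theta> f u(1)[of i] by (intro vec_norm_mult) auto
        then have *: "u i * vec_norm \<theta> N g i powr t = G i powr t * u i powr (- (t - 1))"
          unfolding \<open>vec_norm \<theta> N g i = _\<close> using u(1)[of i] G0[of i] by (simp add: powr_divide powr_diff)
        have "u i * vec_norm \<theta> N g i powr t \<le> G i powr r"
        proof (cases "G i = 0")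
          case True
          then show ?thesis unfolding * by simp
        next
          case False
          then have Gi: "0 < G i" using G0[of i] by simp
          have "u i powr (- (t - 1)) \<le> h i powr (- (t - 1))"
            using u(2)[OF i] Gi r rt by (intro powr_mono2') (auto simp: h_def)
          also have "\<dots> = G i powr (r - t)"
          proof -
            have "(t - 1) / e = t * (1 / s - 1 / \<theta>)"
              using t0 lt r rt by (simp add: e_def divide_simps)
            also have "\<dots> = t * (1 / r - 1 / t)" using t rs by simp
            also have "\<dots> = t / r - 1" using t0 by (simp add: algebra_simps)
            finally have "r * ((t - 1) / e) = r * (t / r - 1)" by (rule arg_cong)
            also have "\<dots> = t - r" using r by (simp add: right_diff_distrib)
            finally have "- (r * ((t - 1) / e)) = r - t" by simp
            then have "r / e * (- (t - 1)) = r - t"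
              by (simp only: mult_minus_right times_divide_eq_left times_divide_eq_right)
            then show ?thesis by (simp add: h_def powr_powr)
          qed
          finally have "G i powr t * u i powr (- (t - 1)) \<le> G i powr t * G i powr (r - t)"
            by (intro mult_left_mono) auto
          then show ?thesis unfolding * using Gi by (simp flip: powr_add)
        qed
        then have "w i * (u i * vec_norm \<theta> N g i powr t) \<le> w i * G i powr r" using w0 by (intro mult_left_mono) auto
        then show "v i * vec_norm \<theta> N g i powr t \<le> w i * G i powr r" by (simp add: v_def mult_ac)
      qed
      then show "(\<Sum>i=A..B. v i * vec_norm \<theta> N g i powr t) \<le> 1" using n by (simp add: G_def)
    qed (use t0 \<theta> in \<open>auto intro!: sum_nonneg mult_nonneg_nonneg less_imp_le[OF v] simp: E_def\<close>)
    finally have HE: "(\<Sum>i=A..B. v i * H i powr \<theta>) \<le> E" by simp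
    \<comment> \<open>Young's inequality with the exponents \<open>s / \<theta>\<close> and \<open>1 - s / \<theta>\<close>; the powers of \<open>u\<close> agree by the choice of \<open>e\<close>.\<close>
    have pt: "F i powr s \<le> (2 * K) powr ((1 - \<alpha>) * \<theta>) * (u i * H i powr \<theta>) + u i powr e" if i: "i \<in> {A..B}" for i
    proof -
      define a where "a = (2 * K) powr ((1 - \<alpha>) * \<theta>) * (u i * H i powr \<theta>)"
      have a0: "0 \<le> a" using u(1)[of i] by (simp add: a_def)
      have st: "s / \<theta> < 1" using s by simp
      have "1 - s / \<theta> = s * (1 / s - 1 / \<theta>)" using s by (simp add: field_simps)
      then have "e * (1 - s / \<theta>) = s * (e * (1 / s - 1 / \<theta>))" by (simp only: mult_ac)
      also have "e * (1 / s - 1 / \<theta>) = 1 - 1 / t"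
        unfolding e_def by (subst times_divide_eq_left, rule nonzero_mult_div_cancel_right) (use lt in linarith)
      also have "s * (1 - 1 / t) = s * (1 - \<alpha>) - s / \<theta>" using t by (simp add: algebra_simps)
      finally have ex: "s / \<theta> + e * (1 - s / \<theta>) = (1 - \<alpha>) * s" by simp
      have "F i powr s \<le> ((2 * K) powr (1 - \<alpha>) * u i powr (1 - \<alpha>) * H i) powr s"
        using FH[OF i] s F0 by (intro powr_mono2) auto
      also have "\<dots> = (2 * K) powr ((1 - \<alpha>) * s) * u i powr ((1 - \<alpha>) * s) * H i powr s"
        using u(1)[of i] K H0 by (simp add: powr_mult powr_powr)
      also have "\<dots> = (2 * K) powr ((1 - \<alpha>) * s) * (u i powr (s / \<theta>) * u i powr (e * (1 - s / \<theta>))) * H i powr s"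
        by (simp only: powr_add[symmetric] ex)
      also have "\<dots> = a powr (s / \<theta>) * (u i powr e) powr (1 - s / \<theta>)"
        using u(1)[of i] K H0[of i] \<theta> by (simp add: a_def powr_mult powr_powr)
      also have "\<dots> \<le> a + u i powr e"
        using a0 st s \<theta> by (intro young_sum) auto
      finally show ?thesis by (simp add: a_def)
    qed
    have "(\<Sum>i=A..B. w i * F i powr s)
        \<le> (\<Sum>i=A..B. w i * ((2 * K) powr ((1 - \<alpha>) * \<theta>) * (u i * H i powr \<theta>) + u i powr e))"
      by (intro sum_mono mult_left_mono pt w0)
    also have "\<dots> = (2 * K) powr ((1 - \<alpha>) * \<theta>) * (\<Sum>i=A..B. v i * H i powr \<theta>) + 2 powr e * (\<Sum>i=A..B. w i * (u i / 2) powr e)"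
      using u(1) by (simp add: sum_distrib_left sum.distrib algebra_simps v_def powr_divide less_imp_le)
    also have "\<dots> \<le> (2 * K) powr ((1 - \<alpha>) * \<theta>) * E + 2 powr e * 1"
      using HE u(4) by (intro add_mono mult_left_mono) auto
    finally show "(\<Sum>i=A..B. w i * vec_norm \<theta> N (\<lambda>k. wmax A B \<alpha> w (f k)) i powr s) \<le> D"
      by (simp add: F_def D_def)
  qed (use r s \<theta> D in auto)
  then show ?thesis using D by blast
qed

lemma vector_bound_exists:
  assumes r: "1 < r" and s: "0 < s" and \<alpha>: "0 \<le> \<alpha>" "\<alpha> < 1" and rs: "1 / r = 1 / s + \<alpha>" and \<theta>: "1 < \<theta>"
  shows "\<exists>D. 0 < D \<and> vector_bound \<alpha> \<theta> r s D"
proof -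
  consider "\<theta> < r" | "r \<le> \<theta>" "\<theta> \<le> s" | "s < \<theta>" by linarith
  then show ?thesis
  proof cases
    case 2
    then have "vector_bound \<alpha> \<theta> r s ((4 * r / (r - 1)) powr r)"
      using r \<alpha> rs by (intro vector_bound_between) auto
    moreover have "0 < (4 * r / (r - 1)) powr r" using r by simp
    ultimately show ?thesis by blast
  qed (use vector_bound_below[OF \<theta> _ s \<alpha> rs] vector_bound_above[OF r s _ \<alpha> rs] in auto)
qed

section \<open>From finite intervals to the integers\<close>

lemma ennpowr_ennreal: "0 \<le> x \<Longrightarrow> ennpowr (ennreal x) r = ennreal (x powr r)"
  by (simp add: ennpowr_def)

lemma ennpowr_mono:
  assumes "x \<le> y" "0 \<le> r"
  shows "ennpowr x r \<le> ennpowr y r"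
proof (cases "y = \<infinity>")
  case False
  then have "x \<noteq> \<infinity>" using assms by (auto simp: top_unique)
  moreover have "enn2real x \<le> enn2real y"
    using assms False by (intro enn2real_mono) (auto simp: less_top)
  ultimately show ?thesis
    using assms False by (auto simp: ennpowr_def intro!: ennreal_leI powr_mono2)
qed (simp add: ennpowr_def)

lemma infsum_ennreal_le_iff:
  fixes f :: "'i \<Rightarrow> ennreal"
  shows "(\<Sum>\<^sub>\<infinity>i\<in>UNIV. f i) \<le> c \<longleftrightarrow> (\<forall>J. finite J \<longrightarrow> sum f J \<le> c)"
  by (subst nonneg_infsum_complete) (auto simp: SUP_le_iff)

lemma wmax_le_frac_max:
  assumes j: "j \<in> {A..B}" and a: "\<And>i. i \<in> {A..B} \<Longrightarrow> cmod (a i) = f i"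
  shows "ennreal (wmax A B \<alpha> (\<lambda>_. 1) f j) \<le> frac_max \<alpha> a j"
proof -
  have "wmax A B \<alpha> (\<lambda>_. 1) f j \<in> (\<lambda>(m, n). (\<Sum>i=m..n. f i * 1) * (\<Sum>i=m..n. 1) powr (\<alpha> - 1)) ` ({A..j} \<times> {j..B})"
    using j unfolding wmax_def by (auto simp del: mult_1_right intro!: Max_in)
  then obtain m n where mn: "A \<le> m" "m \<le> j" "j \<le> n" "n \<le> B"
    and eq: "wmax A B \<alpha> (\<lambda>_. 1) f j = (\<Sum>i=m..n. f i * 1) * (\<Sum>i=m..n. 1) powr (\<alpha> - 1)" by auto
  have "wmax A B \<alpha> (\<lambda>_. 1) f j = 1 / (real_of_int (n - m + 1) powr (1 - \<alpha>)) * (\<Sum>i=m..n. cmod (a i))"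
  proof -
    have "(\<Sum>i=m..n. f i * 1) = (\<Sum>i=m..n. cmod (a i))" using mn a by (intro sum.cong) auto
    then show ?thesis
      unfolding eq using mn by (simp add: powr_minus_divide[of _ "1 - \<alpha>", symmetric])
  qed
  then show ?thesis
    unfolding frac_max_def using mn by (auto intro!: SUP_upper2[of "(m, n)"])
qed

text \<open>Cutting an interval down to \<open>{A..B}\<close> loses no mass of \<open>a\<close> and only increases the negative power of
the length.\<close>
lemma frac_max_le_wmax:
  assumes j: "j \<in> {A..B}" and \<alpha>: "\<alpha> \<le> 1" and supp: "{i. a i \<noteq> 0} \<subseteq> {A..B}"
  shows "frac_max \<alpha> a j \<le> ennreal (wmax A B \<alpha> (\<lambda>_. 1) (\<lambda>i. cmod (a i)) j)"
  unfolding frac_max_def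
proof (intro SUP_least, clarify, intro ennreal_leI)
  fix m n assume mn: "m \<le> j" "j \<le> n"
  define m' n' where "m' = max m A" and "n' = min n B"
  have mn': "A \<le> m'" "m' \<le> j" "j \<le> n'" "n' \<le> B" "m \<le> m'" "n' \<le> n"
    using mn j by (auto simp: m'_def n'_def)
  have "(\<Sum>i=m..n. cmod (a i)) = (\<Sum>i=m'..n'. cmod (a i))"
    using supp by (intro sum.mono_neutral_right) (auto simp: m'_def n'_def)
  moreover have "real_of_int (n - m + 1) powr (\<alpha> - 1) \<le> real_of_int (n' - m' + 1) powr (\<alpha> - 1)"
    using mn' \<alpha> by (intro powr_mono2') auto
  ultimately have "1 / (real_of_int (n - m + 1) powr (1 - \<alpha>)) * (\<Sum>i=m..n. cmod (a i))
      \<le> (\<Sum>i=m'..n'. cmod (a i) * 1) * (\<Sum>i=m'..n'. 1) powr (\<alpha> - 1)"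
    using mn mn' by (simp add: powr_minus_divide[of _ "1 - \<alpha>", symmetric] mult.commute mult_left_mono sum_nonneg)
  also have "\<dots> \<le> wmax A B \<alpha> (\<lambda>_. 1) (\<lambda>i. cmod (a i)) j"
    using mn' by (intro wmax_ge) auto
  finally show "1 / (real_of_int (n - m + 1) powr (1 - \<alpha>)) * (\<Sum>i=m..n. cmod (a i))
      \<le> wmax A B \<alpha> (\<lambda>_. 1) (\<lambda>i. cmod (a i)) j" .
qed

text \<open>Passing from the norm to the modular costs an arbitrarily small increase of the constant, since the
infimum in the norm need not be attained; hence the summand 1 in \<open>K\<close>.\<close>
lemma class_B_modular:
  assumes "\<tau> \<in> class_B"
  obtains K where "0 < K"
    "\<And>A B h. (\<And>i. 0 \<le> h i) \<Longrightarrow> (\<Sum>i=A..B. h i powr \<tau> i) \<le> 1 \<Longrightarrow>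
      (\<Sum>i=A..B. (wmax A B 0 (\<lambda>_. 1) h i / K) powr \<tau> i) \<le> 1"
proof -
  obtain K0 :: real where K0: "\<forall>a\<in>lp_space \<tau>. lp_norm \<tau> (HL_max a) \<le> ennreal K0 * lp_norm \<tau> (modulus a)"
    and \<tau>: "\<And>i. 1 \<le> \<tau> i"
    using assms unfolding class_B_def class_P_def exponent_seq_def by auto
  \<comment> \<open>A negative \<open>K0\<close> counts as 0 in the extended nonnegative reals.\<close>
  define K where "K = max K0 0 + 1"
  have K: "0 < K" by (simp add: K_def)
  have \<tau>0: "0 \<le> \<tau> i" for i using \<tau>[of i] by simp
  show thesis
  proof (rule that[OF K])
    fix A B :: int and h :: "int \<Rightarrow> real"
    assume h: "\<And>i. 0 \<le> h i" and h1: "(\<Sum>i=A..B. h i powr \<tau> i) \<le> 1"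
    define a where "a i = (if i \<in> {A..B} then complex_of_real (h i) else 0)" for i
    have pw: "ennpowr (modulus a i / ennreal 1) (\<tau> i) = ennreal (if i \<in> {A..B} then h i powr \<tau> i else 0)" for i
    proof -
      have "modulus a i / ennreal 1 = ennreal (if i \<in> {A..B} then h i else 0)"
        using h[of i] by (simp add: a_def modulus_def divide_ennreal del: ennreal_1)
      then show ?thesis using h[of i] by (simp add: ennpowr_ennreal)
    qed
    have "(\<Sum>\<^sub>\<infinity>i\<in>UNIV. ennpowr (modulus a i / ennreal 1) (\<tau> i)) \<le> 1"
      unfolding infsum_ennreal_le_iff
    proof (intro allI impI)
      fix J :: "int set" assume J: "finite J"
      have "(\<Sum>i\<in>J. ennpowr (modulus a i / ennreal 1) (\<tau> i)) = ennreal (\<Sum>i\<in>J. if i \<in> {A..B} then h i powr \<tau> i else 0)"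
        unfolding pw by (intro sum_ennreal) auto
      also have "(\<Sum>i\<in>J. if i \<in> {A..B} then h i powr \<tau> i else 0) = (\<Sum>i\<in>J \<inter> {A..B}. h i powr \<tau> i)"
        using J by (simp add: sum.inter_restrict)
      also have "\<dots> \<le> (\<Sum>i=A..B. h i powr \<tau> i)" by (intro sum_mono2) auto
      also note h1
      finally show "(\<Sum>i\<in>J. ennpowr (modulus a i / ennreal 1) (\<tau> i)) \<le> 1" by (simp add: ennreal_leI)
    qed
    then have a1: "lp_norm \<tau> (modulus a) \<le> ennreal 1"
      unfolding lp_norm_def by (intro Inf_lower CollectI exI[of _ "1::real"] conjI) simp_all
    then have "a \<in> lp_space \<tau>" by (auto simp: lp_space_def intro: order_le_less_trans)
    then have "lp_norm \<tau> (HL_max a) \<le> ennreal K0 * lp_norm \<tau> (modulus a)" using K0 by auto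
    also have "\<dots> \<le> ennreal K0 * ennreal 1" using a1 by (intro mult_left_mono) auto
    also have "\<dots> = ennreal K0" by simp
    also have "\<dots> < ennreal K" using K by (intro ennreal_lessI) (auto simp: K_def)
    finally have "lp_norm \<tau> (HL_max a) < ennreal K" .
    then obtain l where l: "0 < l" "ennreal l < ennreal K" "(\<Sum>\<^sub>\<infinity>i\<in>UNIV. ennpowr (HL_max a i / ennreal l) (\<tau> i)) \<le> 1"
      unfolding lp_norm_def Inf_less_iff by blast
    then have lK: "l < K" by (simp add: ennreal_less_iff)
    have "ennreal (\<Sum>i=A..B. (wmax A B 0 (\<lambda>_. 1) h i / K) powr \<tau> i)
        = (\<Sum>i=A..B. ennreal ((wmax A B 0 (\<lambda>_. 1) h i / K) powr \<tau> i))"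
      by (simp add: sum_ennreal)
    also have "\<dots> \<le> (\<Sum>i=A..B. ennpowr (HL_max a i / ennreal l) (\<tau> i))"
    proof (intro sum_mono)
      fix i assume i: "i \<in> {A..B}"
      have M0: "0 \<le> wmax A B 0 (\<lambda>_. 1) h i" using h by (intro wmax_nonneg) auto
      have "ennreal (wmax A B 0 (\<lambda>_. 1) h i / K) \<le> ennreal (wmax A B 0 (\<lambda>_. 1) h i / l)"
        using l(1) lK K M0 by (intro ennreal_leI divide_left_mono) auto
      also have "\<dots> = ennreal (wmax A B 0 (\<lambda>_. 1) h i) / ennreal l"
        using l M0 by (simp add: divide_ennreal)
      also have "\<dots> \<le> HL_max a i / ennreal l"
        using i h by (intro divide_right_mono_ennreal wmax_le_frac_max) (auto simp: a_def)
      finally have "ennpowr (ennreal (wmax A B 0 (\<lambda>_. 1) h i / K)) (\<tau> i) \<le> ennpowr (HL_max a i / ennreal l) (\<tau> i)"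
        using \<tau>0 by (intro ennpowr_mono)
      then show "ennreal ((wmax A B 0 (\<lambda>_. 1) h i / K) powr \<tau> i) \<le> ennpowr (HL_max a i / ennreal l) (\<tau> i)"
        using M0 K by (simp add: ennpowr_ennreal)
    qed
    also have "\<dots> \<le> 1" using l(3) by (simp add: infsum_ennreal_le_iff)
    finally show "(\<Sum>i=A..B. (wmax A B 0 (\<lambda>_. 1) h i / K) powr \<tau> i) \<le> 1" by simp
  qed
qed

lemma lp_norm_le_mult:
  assumes C: "0 < C"
    and step: "\<And>l. 0 < l \<Longrightarrow> (\<Sum>\<^sub>\<infinity>i\<in>UNIV. ennpowr (G i / ennreal l) (p i)) \<le> 1 \<Longrightarrow>
      (\<Sum>\<^sub>\<infinity>i\<in>UNIV. ennpowr (F i / ennreal (C * l)) (q i)) \<le> 1"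
  shows "lp_norm q F \<le> ennreal C * lp_norm p G"
proof -
  have "lp_norm q F / ennreal C \<le> lp_norm p G"
    unfolding lp_norm_def[of p]
  proof (rule Inf_greatest, clarify)
    fix l :: real assume l: "0 < l" "(\<Sum>\<^sub>\<infinity>i\<in>UNIV. ennpowr (G i / ennreal l) (p i)) \<le> 1"
    have "lp_norm q F \<le> ennreal (C * l)"
      unfolding lp_norm_def using step[OF l] C l(1) by (intro Inf_lower) (auto intro!: exI[of _ "C * l"])
    then have "lp_norm q F / ennreal C \<le> ennreal (C * l) / ennreal C"
      by (rule divide_right_mono_ennreal)
    also have "\<dots> = ennreal l" using C l by (simp add: divide_ennreal)
    finally show "lp_norm q F / ennreal C \<le> ennreal l" .
  qed
  then have "ennreal C * (lp_norm q F / ennreal C) \<le> ennreal C * lp_norm p G"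
    by (intro mult_left_mono) auto
  moreover have "ennreal C * (lp_norm q F / ennreal C) = lp_norm q F"
    using C by (simp add: ennreal_times_divide ennreal_mult_divide_eq mult.commute[of "ennreal C"])
  ultimately show ?thesis by simp
qed

text \<open>The weights produced by extrapolation from the variable exponent are \<open>A\<^sub>1\<close> with the constant \<open>2 K\<close>
for every interval \<open>{A..B}\<close>, so \<open>C\<close> depends neither on the interval nor on the length \<open>N\<close> of the family.\<close>
lemma modular_vector_bound:
  fixes p q :: "int \<Rightarrow> real"
  assumes \<alpha>: "0 \<le> \<alpha>" "\<alpha> < 1" and s: "1 / (1 - \<alpha>) < s" and q: "\<And>i. s < q i"
    and B: "conj_exp (\<lambda>i. q i / s) \<in> class_B"
    and p: "\<And>i. 1 / p i = 1 / q i + \<alpha>" and \<theta>: "1 < \<theta>"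
  obtains C where "0 < C"
    "\<And>A B f N. A \<le> B \<Longrightarrow> (\<And>k i. 0 \<le> f k i) \<Longrightarrow> (\<Sum>i=A..B. vec_norm \<theta> N f i powr p i) \<le> 1 \<Longrightarrow>
      (\<Sum>i=A..B. (vec_norm \<theta> N (\<lambda>k. wmax A B \<alpha> (\<lambda>_. 1) (f k)) i / C) powr q i) \<le> 1"
proof -
  have "1 \<le> 1 / (1 - \<alpha>)" using \<alpha> by simp
  then have s1: "1 < s" using s by linarith
  define r where "r = 1 / (1 / s + \<alpha>)"
  have "1 / s < 1 - \<alpha>" using s s1 \<alpha> by (simp add: field_simps)
  moreover have pos: "0 < 1 / s + \<alpha>" using s1 \<alpha> by (simp add: add_pos_nonneg)
  ultimately have r: "1 < r" "1 / r = 1 / s + \<alpha>" by (simp_all add: r_def)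
  have conj: "conj_exp (\<lambda>i. q i / s) i = q i / (q i - s)" for i
    using q[of i] s1 by (simp add: conj_exp_def field_simps)
  obtain K where K: "0 < K"
    "\<And>A B h. (\<And>i. 0 \<le> h i) \<Longrightarrow> (\<Sum>i=A..B. h i powr (q i / (q i - s))) \<le> 1 \<Longrightarrow>
      (\<Sum>i=A..B. (wmax A B 0 (\<lambda>_. 1) h i / K) powr (q i / (q i - s))) \<le> 1"
  proof (rule class_B_modular[OF B, unfolded conj])
    fix K assume 1: "0 < K" and 2: "\<And>A B h. (\<And>i. 0 \<le> h i) \<Longrightarrow> (\<Sum>i=A..B. h i powr (q i / (q i - s))) \<le> 1 \<Longrightarrow>
      (\<Sum>i=A..B. (wmax A B 0 (\<lambda>_. 1) h i / K) powr (q i / (q i - s))) \<le> 1"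
    show thesis by (rule that[OF 1 2])
  qed
  obtain E where E: "0 < E" "vector_bound \<alpha> \<theta> r s E"
    using vector_bound_exists[OF r(1) _ \<alpha> r(2) \<theta>] s1 by auto
  define D where "D = (2 * K) powr ((1 - \<alpha>) * s) * E"
  have D: "0 < D" using K E by (simp add: D_def)
  define C where "C = (D * 2 powr (s / r) * 2) powr (1 / s)"
  have "0 < C" using D by (simp add: C_def)
  moreover have "(\<Sum>i=A..B. (vec_norm \<theta> N (\<lambda>k. wmax A B \<alpha> (\<lambda>_. 1) (f k)) i / C) powr q i) \<le> 1"
    if AB: "A \<le> B" and f: "\<And>k i. 0 \<le> f k i" and G: "(\<Sum>i=A..B. vec_norm \<theta> N f i powr p i) \<le> 1" for A B f N
  proof -
    have "(\<Sum>i=A..B. 1 * (vec_norm \<theta> N (\<lambda>k. wmax A B \<alpha> (\<lambda>_. 1) (f k)) i / C) powr q i) \<le> 1"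
      unfolding C_def
    proof (rule off_diagonal_extrapolation[where p = p and r = r and s = s and K = K and \<alpha> = \<alpha> and G = "vec_norm \<theta> N f"])
      show "(\<Sum>i=A..B. 1 * (wmax A B 0 (\<lambda>_. 1) h i / K) powr (q i / (q i - s))) \<le> 1"
        if "\<And>i. 0 \<le> h i" "(\<Sum>i=A..B. 1 * h i powr (q i / (q i - s))) \<le> 1" for h
        using K(2)[of h A B] that by simp
      show "(\<Sum>i=A..B. 1 * (vec_norm \<theta> N (\<lambda>k. wmax A B \<alpha> (\<lambda>_. 1) (f k)) i powr s * u i))
        \<le> D * (\<Sum>i=A..B. 1 * (vec_norm \<theta> N f i powr r * u i powr (r / s))) powr (s / r)"
        if "\<And>i. 0 < u i" "\<And>i. i \<in> {A..B} \<Longrightarrow> wmax A B 0 (\<lambda>_. 1) u i \<le> 2 * K * u i" for u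
        unfolding D_def using E r s1 \<theta> \<alpha> AB K that f by (intro vector_bound_A1_weight) auto
    qed (use r s1 \<alpha> q p K D G in \<open>auto simp: vec_norm_nonneg\<close>)
    then show ?thesis by simp
  qed
  ultimately show thesis by (rule that)
qed

theorem theorem1p4:
  fixes \<alpha> s \<theta> :: real and p q :: "int \<Rightarrow> real"
  assumes "0 \<le> \<alpha>" and "\<alpha> < 1"
    and "exponent_seq q"
    and "1 / (1 - \<alpha>) < s" and "ereal s < exp_minus q"
    and "conj_exp (\<lambda>i. q i / s) \<in> class_B"
    and "exponent_seq p" and "\<And>i. 1 / p i = 1 / q i + \<alpha>"
    and "1 < \<theta>"
  shows "\<exists>C::real. C > 0 \<and>
    (\<forall>a :: nat \<Rightarrow> int \<Rightarrow> complex. (\<forall>k. finite {i. a k i \<noteq> 0}) \<longrightarrow>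
       lp_norm q (\<lambda>j. ennpowr (\<Sum>k. ennpowr (frac_max \<alpha> (a k) j) \<theta>) (1 / \<theta>))
         \<le> ennreal C * lp_norm p (\<lambda>j. ennpowr (\<Sum>k. ennpowr (modulus (a k) j) \<theta>) (1 / \<theta>)))"
proof -
  have sq: "s < q i" for i
  proof -
    have "exp_minus q \<le> ereal (q i)" unfolding exp_minus_def by (intro INF_lower) auto
    then have "ereal s < ereal (q i)" using assms(5) by (rule less_le_trans[rotated])
    then show ?thesis by simp
  qed
  have q0: "0 < q i" and p0: "0 < p i" for i
    using assms(3,7) unfolding exponent_seq_def by (auto intro: less_le_trans[OF zero_less_one])
  obtain C where C: "0 < C"
    "\<And>A B f N. A \<le> B \<Longrightarrow> (\<And>k i. 0 \<le> f k i) \<Longrightarrow> (\<Sum>i=A..B. vec_norm \<theta> N f i powr p i) \<le> 1 \<Longrightarrow>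
      (\<Sum>i=A..B. (vec_norm \<theta> N (\<lambda>k. wmax A B \<alpha> (\<lambda>_. 1) (f k)) i / C) powr q i) \<le> 1"
  proof (rule modular_vector_bound[OF assms(1,2,4) sq assms(6,8,9)])
    fix C assume 1: "0 < C" and 2: "\<And>A B f N. A \<le> B \<Longrightarrow> (\<And>k i. 0 \<le> f k i) \<Longrightarrow> (\<Sum>i=A..B. vec_norm \<theta> N f i powr p i) \<le> 1 \<Longrightarrow>
      (\<Sum>i=A..B. (vec_norm \<theta> N (\<lambda>k. wmax A B \<alpha> (\<lambda>_. 1) (f k)) i / C) powr q i) \<le> 1"
    show thesis by (rule that[OF 1 2])
  qed
  have "lp_norm q (\<lambda>j. ennpowr (\<Sum>k. ennpowr (frac_max \<alpha> (a k) j) \<theta>) (1 / \<theta>))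
         \<le> ennreal C * lp_norm p (\<lambda>j. ennpowr (\<Sum>k. ennpowr (modulus (a k) j) \<theta>) (1 / \<theta>))"
    if fin: "\<forall>k. finite {i. a k i \<noteq> 0}" for a :: "nat \<Rightarrow> int \<Rightarrow> complex"
  proof (rule lp_norm_le_mult[OF C(1)])
    fix l :: real assume l: "0 < l"
      and G1: "(\<Sum>\<^sub>\<infinity>i\<in>UNIV. ennpowr (ennpowr (\<Sum>k. ennpowr (modulus (a k) i) \<theta>) (1 / \<theta>) / ennreal l) (p i)) \<le> 1"
    define f where "f k i = cmod (a k i)" for k i
    define M where "M k j = enn2real (frac_max \<alpha> (a k) j)" for k j
    have f0: "0 \<le> f k i" and M0: "0 \<le> M k i" for k i by (simp_all add: f_def M_def)
    have Cl: "0 < C * l" using C l by simp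
    have box: "\<exists>A B. A \<le> B \<and> S \<subseteq> {A..B}" if "finite S" for S :: "int set"
    proof -
      define b where "b = (\<Sum>x\<in>S. \<bar>x\<bar>)"
      have "\<bar>x\<bar> \<le> b" if "x \<in> S" for x
        unfolding b_def using \<open>finite S\<close> that by (intro member_le_sum) auto
      then have "S \<subseteq> {- b..b}" by (fastforce simp: abs_le_iff)
      moreover have "0 \<le> b" unfolding b_def by (intro sum_nonneg) auto
      ultimately show ?thesis by (intro exI[of _ "- b"] exI[of _ b]) auto
    qed
    have fmaxM: "frac_max \<alpha> (a k) j = ennreal (M k j)" for k j
    proof -
      obtain A B where "insert j {i. a k i \<noteq> 0} \<subseteq> {A..B}"
        using box[of "insert j {i. a k i \<noteq> 0}"] fin by auto
      then have "frac_max \<alpha> (a k) j \<le> ennreal (wmax A B \<alpha> (\<lambda>_. 1) (\<lambda>i. cmod (a k i)) j)"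
        using assms(2) by (intro frac_max_le_wmax) auto
      then have "frac_max \<alpha> (a k) j < top" using ennreal_less_top by (rule le_less_trans)
      then show ?thesis by (simp add: M_def)
    qed
    \<comment> \<open>Finitely many points and finitely many functions fit into one interval \<open>{A..B}\<close>.\<close>
    have finite_bound: "(\<Sum>j\<in>J. (vec_norm \<theta> N M j / (C * l)) powr q j) \<le> 1" if J: "finite J" for J N
    proof -
      obtain A B where AB: "A \<le> B" and sub: "J \<union> (\<Union>k<N. {i. a k i \<noteq> 0}) \<subseteq> {A..B}"
        using box[of "J \<union> (\<Union>k<N. {i. a k i \<noteq> 0})"] J fin by auto
      define g where "g k i = f k i * (1 / l)" for k i
      have "ennreal (\<Sum>i=A..B. vec_norm \<theta> N g i powr p i) = (\<Sum>i=A..B. ennreal (vec_norm \<theta> N g i powr p i))"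
        by (simp add: sum_ennreal)
      also have "\<dots> \<le> (\<Sum>i=A..B. ennpowr (ennpowr (\<Sum>k. ennpowr (modulus (a k) i) \<theta>) (1 / \<theta>) / ennreal l) (p i))"
      proof (intro sum_mono)
        fix i
        have "ennreal (\<Sum>k<N. f k i powr \<theta>) = (\<Sum>k<N. ennpowr (modulus (a k) i) \<theta>)"
          by (simp add: modulus_def ennpowr_ennreal sum_ennreal f_def)
        also have "\<dots> \<le> (\<Sum>k. ennpowr (modulus (a k) i) \<theta>)" by (intro sum_le_suminf) auto
        finally have "ennpowr (ennreal (\<Sum>k<N. f k i powr \<theta>)) (1 / \<theta>) \<le> ennpowr (\<Sum>k. ennpowr (modulus (a k) i) \<theta>) (1 / \<theta>)"
          using assms(9) by (intro ennpowr_mono) auto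
        then have "ennreal (vec_norm \<theta> N f i) \<le> ennpowr (\<Sum>k. ennpowr (modulus (a k) i) \<theta>) (1 / \<theta>)"
          by (simp add: vec_norm_def ennpowr_ennreal sum_nonneg)
        then have "ennreal (vec_norm \<theta> N f i) / ennreal l \<le> ennpowr (\<Sum>k. ennpowr (modulus (a k) i) \<theta>) (1 / \<theta>) / ennreal l"
          by (rule divide_right_mono_ennreal)
        moreover have "vec_norm \<theta> N g i = vec_norm \<theta> N f i * (1 / l)"
          unfolding g_def using assms(9) l f0 by (intro vec_norm_mult) auto
        then have "ennreal (vec_norm \<theta> N f i) / ennreal l = ennreal (vec_norm \<theta> N g i)"
          using l by (simp add: divide_ennreal vec_norm_nonneg)
        ultimately have "ennpowr (ennreal (vec_norm \<theta> N g i)) (p i) \<le> ennpowr (ennpowr (\<Sum>k. ennpowr (modulus (a k) i) \<theta>) (1 / \<theta>) / ennreal l) (p i)"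
          using p0[of i] by (intro ennpowr_mono) auto
        then show "ennreal (vec_norm \<theta> N g i powr p i) \<le> \<dots>"
          by (simp add: ennpowr_ennreal vec_norm_nonneg)
      qed
      also have "\<dots> \<le> 1" using G1 by (simp add: infsum_ennreal_le_iff)
      finally have "(\<Sum>i=A..B. vec_norm \<theta> N g i powr p i) \<le> 1" by simp
      then have bound: "(\<Sum>i=A..B. (vec_norm \<theta> N (\<lambda>k. wmax A B \<alpha> (\<lambda>_. 1) (g k)) i / C) powr q i) \<le> 1"
        using AB f0 l by (intro C(2)) (auto simp: g_def)
      have M_le: "vec_norm \<theta> N M j \<le> l * vec_norm \<theta> N (\<lambda>k. wmax A B \<alpha> (\<lambda>_. 1) (g k)) j" if j: "j \<in> J" for j
      proof -
        have jX: "j \<in> {A..B}" using sub j by auto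
        have "M k j \<le> l * wmax A B \<alpha> (\<lambda>_. 1) (g k) j" if k: "k < N" for k
        proof -
          have W0: "0 \<le> wmax A B \<alpha> (\<lambda>_. 1) (f k) j" using f0 by (intro wmax_nonneg) auto
          have "ennreal (M k j) \<le> ennreal (wmax A B \<alpha> (\<lambda>_. 1) (f k) j)"
            unfolding fmaxM[symmetric] f_def using assms(2) jX sub k by (intro frac_max_le_wmax) auto
          then have "M k j \<le> wmax A B \<alpha> (\<lambda>_. 1) (f k) j" using W0 by simp
          also have "\<dots> \<le> 1 / (1 / l) * wmax A B \<alpha> (\<lambda>_. 1) (g k) j"
            unfolding g_def using l jX by (intro wmax_scale) auto
          finally show ?thesis by simp
        qed
        then show ?thesis
          using assms(9) l M0 f0 by (intro vec_norm_le_mult) (auto simp: g_def intro!: wmax_nonneg)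
      qed
      have "(\<Sum>j\<in>J. (vec_norm \<theta> N M j / (C * l)) powr q j) \<le> (\<Sum>j\<in>J. (vec_norm \<theta> N (\<lambda>k. wmax A B \<alpha> (\<lambda>_. 1) (g k)) j / C) powr q j)"
        using M_le C l q0 by (intro sum_mono powr_mono2) (auto simp: vec_norm_nonneg field_simps less_imp_le)
      also have "\<dots> \<le> (\<Sum>j=A..B. (vec_norm \<theta> N (\<lambda>k. wmax A B \<alpha> (\<lambda>_. 1) (g k)) j / C) powr q j)"
        using sub by (intro sum_mono2) auto
      finally show ?thesis using bound by simp
    qed
    \<comment> \<open>The limit function over all \<open>k\<close> is finite, by the uniform bound at the single point \<open>j\<close>.\<close>
    define L where "L j = (\<Sum>k. M k j powr \<theta>) powr (1 / \<theta>)" for j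
    have sm: "summable (\<lambda>k. M k j powr \<theta>)" for j
    proof (rule summableI_nonneg_bounded)
      fix N
      have "(vec_norm \<theta> N M j / (C * l)) powr q j \<le> 1" using finite_bound[of "{j}" N] by simp
      then have "((vec_norm \<theta> N M j / (C * l)) powr q j) powr (1 / q j) \<le> 1 powr (1 / q j)"
        using q0[of j] by (intro powr_mono2) auto
      then have "vec_norm \<theta> N M j \<le> C * l" using q0[of j] Cl by (simp add: powr_powr vec_norm_nonneg)
      then have "vec_norm \<theta> N M j powr \<theta> \<le> (C * l) powr \<theta>"
        using assms(9) by (intro powr_mono2) (auto simp: vec_norm_nonneg)
      then show "(\<Sum>k<N. M k j powr \<theta>) \<le> (C * l) powr \<theta>"
        using assms(9) by (simp add: vec_norm_def powr_powr sum_nonneg)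
    qed simp
    have FL: "ennpowr (\<Sum>k. ennpowr (frac_max \<alpha> (a k) j) \<theta>) (1 / \<theta>) = ennreal (L j)" for j
      unfolding fmaxM using sm[of j] M0 by (simp add: ennpowr_ennreal suminf_ennreal2 suminf_nonneg L_def)
    show "(\<Sum>\<^sub>\<infinity>i\<in>UNIV. ennpowr (ennpowr (\<Sum>k. ennpowr (frac_max \<alpha> (a k) i) \<theta>) (1 / \<theta>) / ennreal (C * l)) (q i)) \<le> 1"
      unfolding infsum_ennreal_le_iff
    proof (intro allI impI)
      fix J :: "int set" assume J: "finite J"
      have lim: "(\<lambda>N. vec_norm \<theta> N M j) \<longlonglongrightarrow> L j" for j
        unfolding vec_norm_def L_def using assms(9) summable_LIMSEQ[OF sm[of j]]
        by (intro tendsto_powr') (auto intro!: always_eventually sum_nonneg)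
      have "(\<lambda>N. \<Sum>j\<in>J. (vec_norm \<theta> N M j / (C * l)) powr q j) \<longlonglongrightarrow> (\<Sum>j\<in>J. (L j / (C * l)) powr q j)"
        using Cl q0 by (intro tendsto_sum tendsto_powr' tendsto_divide lim tendsto_const)
          (auto intro!: always_eventually divide_nonneg_pos simp: vec_norm_nonneg)
      then have "(\<Sum>j\<in>J. (L j / (C * l)) powr q j) \<le> 1"
        by (rule LIMSEQ_le_const2) (use finite_bound[OF J] in auto)
      moreover have "(\<Sum>j\<in>J. ennpowr (ennpowr (\<Sum>k. ennpowr (frac_max \<alpha> (a k) j) \<theta>) (1 / \<theta>) / ennreal (C * l)) (q j))
          = ennreal (\<Sum>j\<in>J. (L j / (C * l)) powr q j)"
        unfolding FL using Cl by (simp add: divide_ennreal L_def ennpowr_ennreal sum_ennreal)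
      ultimately show "(\<Sum>j\<in>J. ennpowr (ennpowr (\<Sum>k. ennpowr (frac_max \<alpha> (a k) j) \<theta>) (1 / \<theta>) / ennreal (C * l)) (q j)) \<le> 1"
        by simp
    qed
  qed
  then show ?thesis using C(1) by blast
qed

end
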